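(* Let $G$ be an $H$-free clique-Sperner split graph with at least two vertices and let $(K,I)$ be any split partition of $G$ such that the labeled split graph $(G,K,I)$ is clique-Sperner. Then there exists a partition of $K$ as $K = K^1\cup K^2$ and a partition of $I$ as $I = \{z\}\cup I^1\cup I^2$ such that $\{\{z\},I^1,I^2,K^1,K^2\}$ is an $M[0,1]$-partition of $G$ (rows and columns indexed in order by $\{z\},I^1,I^2,K^1,K^2$) such that the labeled split subgraphs $(G_1,K^1,I^1)$ and $(G_2,K^2,I^2)$ of $(G,K,I)$ induced by $K^1\cup I^1$ and $K^2\cup I^2$ (with inherited split partitions) are $H$-free and clique-Sperner. Moreover, given an $H$-free split graph $G$, one can compute in time $\mathcal{O}(|V(G)|^3)$ a split partition $(K,I)$ of $G$ such that $(G,K,I)$ is clique-Sperner, together with an $M[0,1]$-partition $\{\{z\},I^1,I^2,K^1,K^2\}$ of $G$ with $K=K^1\cup K^2$, $I=\{z\}\cup I^1\cup I^2$ such that the labeled split subgraphs induced by $K^1\cup I^1$ and $K^2\cup I^2$ are $H$-free and clique-Sperner, or determine that $G$ is not clique-Sperner.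
   Context: Graphs are finite, simple, undirected. $H$ is the 6-vertex split graph obtained from $2P_3$ (disjoint union of two 3-vertex paths) by adding an edge between the two vertices of degree two; its unique split partition has $K$ = the two (adjacent) centers and $I$ = the four leaves. A labeled split graph $(G,K,I)$ is a split graph $G$ with split partition $(K,I)$ ($K$ a clique, $I$ an independent set). It is clique-Sperner if for all $u,v\in K$, $N(u)\cap I\subseteq N(v)\cap I$ implies $u=v$; a split graph is clique-Sperner if it has a split partition making it clique-Sperner. For a symmetric $m\times m$ matrix $M$ over $\{0,1,\ast\}$, an $M$-partition of $G$ is a partition of $V(G)$ into (possibly empty) parts $V_1,\dots,V_m$ such that distinct vertices in $V_i,V_j$ (possibly $i=j$) are adjacent if $M_{ij}=1$ and nonadjacent if $M_{ij}=0$ (no constraint if $\ast$). For $(a,b)\in\{0,1\}^2$, $M[a,b]=\begin{pmatrix} a&a&a&1&0\\ a&a&a&\ast&1\\ a&a&a&0&\ast\\ 1&\ast&0&b&b\\ 0&1&\ast&b&b\end{pmatrix}$. *)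

theory Defs
  imports
    "Graph_Theory.Pair_Digraph"
    "Graph_Theory.Digraph_Isomorphism"
    "HOL-Library.Landau_Symbols"
begin

section \<open>Split graphs\<close>

text \<open>
  A finite simple undirected graph is a digraph satisfying the locale predicate \<^const>\<open>graph\<close>
  of the Graph_Theory library: finite, loopless, without parallel arcs, and with a symmetric arc
  relation. Adjacency of \<open>u\<close> and \<open>v\<close> is \<open>u \<rightarrow>\<^bsub>G\<^esub> v\<close>, and \<open>G \<restriction> S\<close> is the subgraph
  induced by \<open>S\<close>.
\<close>

definition nbhd :: "('a, 'b) pre_digraph \<Rightarrow> 'a \<Rightarrow> 'a set" where
  "nbhd G u = {v. u \<rightarrow>\<^bsub>G\<^esub> v}"

definition is_clique :: "('a, 'b) pre_digraph \<Rightarrow> 'a set \<Rightarrow> bool" where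
  "is_clique G K \<longleftrightarrow> K \<subseteq> verts G \<and> (\<forall>u\<in>K. \<forall>v\<in>K. u \<noteq> v \<longrightarrow> u \<rightarrow>\<^bsub>G\<^esub> v)"

definition is_independent :: "('a, 'b) pre_digraph \<Rightarrow> 'a set \<Rightarrow> bool" where
  "is_independent G I \<longleftrightarrow> I \<subseteq> verts G \<and> (\<forall>u\<in>I. \<forall>v\<in>I. \<not> u \<rightarrow>\<^bsub>G\<^esub> v)"

definition split_partition :: "('a, 'b) pre_digraph \<Rightarrow> 'a set \<Rightarrow> 'a set \<Rightarrow> bool" where
  "split_partition G K I \<longleftrightarrow>
     verts G = K \<union> I \<and> K \<inter> I = {} \<and> is_clique G K \<and> is_independent G I"

definition split_graph :: "('a, 'b) pre_digraph \<Rightarrow> bool" where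
  "split_graph G \<longleftrightarrow> (\<exists>K I. split_partition G K I)"

definition labeled_clique_sperner :: "('a, 'b) pre_digraph \<Rightarrow> 'a set \<Rightarrow> 'a set \<Rightarrow> bool" where
  "labeled_clique_sperner G K I \<longleftrightarrow>
     split_partition G K I \<and>
     (\<forall>u\<in>K. \<forall>v\<in>K. nbhd G u \<inter> I \<subseteq> nbhd G v \<inter> I \<longrightarrow> u = v)"

definition clique_sperner :: "('a, 'b) pre_digraph \<Rightarrow> bool" where
  "clique_sperner G \<longleftrightarrow> (\<exists>K I. labeled_clique_sperner G K I)"

definition induced_free :: "('c, 'd) pre_digraph \<Rightarrow> ('a, 'b) pre_digraph \<Rightarrow> bool" where
  "induced_free F G \<longleftrightarrow> \<not> (\<exists>S. S \<subseteq> verts G \<and> digraph_iso F (G \<restriction> S))"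

text \<open>The paths \<open>1 - 0 - 2\<close> and \<open>4 - 3 - 5\<close>, with their centers \<open>0\<close> and \<open>3\<close> joined.\<close>

definition H_graph :: "(nat, nat \<times> nat) pre_digraph" where
  "H_graph = with_proj
     (let E = {(1, 0), (0, 2), (4, 3), (3, 5), (0, 3)}
      in \<lparr> pverts = {0, 1, 2, 3, 4, 5}, parcs = E \<union> E\<inverse> \<rparr>)"

abbreviation H_free :: "('a, 'b) pre_digraph \<Rightarrow> bool" where
  "H_free G \<equiv> induced_free H_graph G"

lemma graph_H_graph: "graph H_graph"
  unfolding H_graph_def
  by (rule pair_graph.pair_graphD_graph, unfold_locales)
    (auto simp: symmetric_def sym_def Let_def)

lemma split_partition_H_graph: "split_partition H_graph {0, 3} {1, 2, 4, 5}"
  by (auto simp: split_partition_def is_clique_def is_independent_def H_graph_def Let_def)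


section \<open>Matrix partitions\<close>

datatype entry = Zero | One | Star

text \<open>
  Matrices are lists of rows and the parts are listed in the order of the rows; parts may be
  empty, so disjointness is imposed on positions in the list.
\<close>

definition M_partition :: "entry list list \<Rightarrow> ('a, 'b) pre_digraph \<Rightarrow> 'a set list \<Rightarrow> bool" where
  "M_partition M G Vs \<longleftrightarrow>
     length Vs = length M \<and>
     \<Union> (set Vs) = verts G \<and>
     (\<forall>i<length Vs. \<forall>j<length Vs. i \<noteq> j \<longrightarrow> Vs ! i \<inter> Vs ! j = {}) \<and>
     (\<forall>i<length Vs. \<forall>j<length Vs. \<forall>u\<in>Vs ! i. \<forall>v\<in>Vs ! j. u \<noteq> v \<longrightarrow>
        (M ! i ! j = One \<longrightarrow> u \<rightarrow>\<^bsub>G\<^esub> v) \<and> (M ! i ! j = Zero \<longrightarrow> \<not> u \<rightarrow>\<^bsub>G\<^esub> v))"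

definition M_matrix :: "entry \<Rightarrow> entry \<Rightarrow> entry list list" where
  "M_matrix a b =
     [[a,   a,    a,    One,  Zero],
      [a,   a,    a,    Star, One ],
      [a,   a,    a,    Zero, Star],
      [One, Star, Zero, b,    b   ],
      [Zero, One, Star, b,    b   ]]"

lemma M_matrix_symmetric:
  "i < 5 \<Longrightarrow> j < 5 \<Longrightarrow> M_matrix a b ! i ! j = M_matrix a b ! j ! i"
  by (auto simp: M_matrix_def less_Suc_eq numeral_eq_Suc)

definition sperner_decomposition ::
  "('a, 'b) pre_digraph \<Rightarrow> 'a set \<Rightarrow> 'a set \<Rightarrow> 'a \<Rightarrow> 'a set \<Rightarrow> 'a set \<Rightarrow> 'a set \<Rightarrow> 'a set \<Rightarrow> bool"
where
  "sperner_decomposition G K I z I\<^sub>1 I\<^sub>2 K\<^sub>1 K\<^sub>2 \<longleftrightarrow>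
     K = K\<^sub>1 \<union> K\<^sub>2 \<and> K\<^sub>1 \<inter> K\<^sub>2 = {} \<and>
     I = {z} \<union> I\<^sub>1 \<union> I\<^sub>2 \<and> z \<notin> I\<^sub>1 \<and> z \<notin> I\<^sub>2 \<and> I\<^sub>1 \<inter> I\<^sub>2 = {} \<and>
     M_partition (M_matrix Zero One) G [{z}, I\<^sub>1, I\<^sub>2, K\<^sub>1, K\<^sub>2] \<and>
     H_free (G \<restriction> (K\<^sub>1 \<union> I\<^sub>1)) \<and> labeled_clique_sperner (G \<restriction> (K\<^sub>1 \<union> I\<^sub>1)) K\<^sub>1 I\<^sub>1 \<and>
     H_free (G \<restriction> (K\<^sub>2 \<union> I\<^sub>2)) \<and> labeled_clique_sperner (G \<restriction> (K\<^sub>2 \<union> I\<^sub>2)) K\<^sub>2 I\<^sub>2"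


section \<open>A word RAM\<close>

text \<open>
  Running times refer to structured programs for a random access machine with registers and
  arrays of natural numbers, initially zero apart from the input. A program mentions only
  finitely many registers and arrays. The parameter \<open>w\<close> is the largest number that fits into a
  machine word: evaluation gets stuck when a constant or an intermediate result exceeds \<open>w\<close>, so
  that unit-cost arithmetic cannot be exploited on huge numbers.
\<close>

datatype exp =
    Const nat
  | Reg nat
  | Load nat exp  \<comment> \<open>array, index\<close>
  | Add exp exp
  | Sub exp exp   \<comment> \<open>truncated at zero\<close>
  | Mul exp exp
  | Lt exp exp    \<comment> \<open>1 or 0\<close>

datatype com =
    Skip
  | Assign nat exp
  | Store nat exp exp  \<comment> \<open>array, index, value\<close>
  | Seq com com
  | If exp com com     \<comment> \<open>a nonzero value counts as true\<close>
  | While exp com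

record state =
  regs :: "nat \<Rightarrow> nat"
  arrs :: "nat \<Rightarrow> nat \<Rightarrow> nat"

definition word :: "nat \<Rightarrow> nat \<Rightarrow> nat option" where
  "word w x = (if x \<le> w then Some x else None)"

fun aval :: "nat \<Rightarrow> exp \<Rightarrow> state \<Rightarrow> nat option" where
  "aval w (Const c) s = word w c"
| "aval w (Reg r) s = word w (regs s r)"
| "aval w (Load a e) s = Option.bind (aval w e s) (\<lambda>i. word w (arrs s a i))"
| "aval w (Add e\<^sub>1 e\<^sub>2) s =
     Option.bind (aval w e\<^sub>1 s) (\<lambda>x. Option.bind (aval w e\<^sub>2 s) (\<lambda>y. word w (x + y)))"
| "aval w (Sub e\<^sub>1 e\<^sub>2) s =
     Option.bind (aval w e\<^sub>1 s) (\<lambda>x. Option.bind (aval w e\<^sub>2 s) (\<lambda>y. word w (x - y)))"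
| "aval w (Mul e\<^sub>1 e\<^sub>2) s =
     Option.bind (aval w e\<^sub>1 s) (\<lambda>x. Option.bind (aval w e\<^sub>2 s) (\<lambda>y. word w (x * y)))"
| "aval w (Lt e\<^sub>1 e\<^sub>2) s =
     Option.bind (aval w e\<^sub>1 s) (\<lambda>x. Option.bind (aval w e\<^sub>2 s)
       (\<lambda>y. word w (if x < y then 1 else 0)))"

primrec ecost :: "exp \<Rightarrow> nat" where
  "ecost (Const c) = 1"
| "ecost (Reg r) = 1"
| "ecost (Load a e) = ecost e + 1"
| "ecost (Add e\<^sub>1 e\<^sub>2) = ecost e\<^sub>1 + ecost e\<^sub>2 + 1"
| "ecost (Sub e\<^sub>1 e\<^sub>2) = ecost e\<^sub>1 + ecost e\<^sub>2 + 1"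
| "ecost (Mul e\<^sub>1 e\<^sub>2) = ecost e\<^sub>1 + ecost e\<^sub>2 + 1"
| "ecost (Lt e\<^sub>1 e\<^sub>2) = ecost e\<^sub>1 + ecost e\<^sub>2 + 1"

text \<open>\<open>exec w c s t s'\<close>: from state \<open>s\<close>, the program \<open>c\<close> halts in state \<open>s'\<close> after \<open>t\<close> steps.\<close>

inductive exec :: "nat \<Rightarrow> com \<Rightarrow> state \<Rightarrow> nat \<Rightarrow> state \<Rightarrow> bool" for w where
  exec_Skip: "exec w Skip s 1 s"
| exec_Assign:
    "aval w e s = Some x \<Longrightarrow>
     exec w (Assign r e) s (ecost e + 1) (s\<lparr>regs := (regs s)(r := x)\<rparr>)"
| exec_Store:
    "aval w e\<^sub>1 s = Some i \<Longrightarrow> aval w e\<^sub>2 s = Some x \<Longrightarrow>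
     exec w (Store a e\<^sub>1 e\<^sub>2) s (ecost e\<^sub>1 + ecost e\<^sub>2 + 1)
       (s\<lparr>arrs := (arrs s)(a := (arrs s a)(i := x))\<rparr>)"
| exec_Seq:
    "exec w c\<^sub>1 s t\<^sub>1 s' \<Longrightarrow> exec w c\<^sub>2 s' t\<^sub>2 s'' \<Longrightarrow> exec w (Seq c\<^sub>1 c\<^sub>2) s (t\<^sub>1 + t\<^sub>2) s''"
| exec_If_true:
    "aval w e s = Some x \<Longrightarrow> x \<noteq> 0 \<Longrightarrow> exec w c\<^sub>1 s t s' \<Longrightarrow>
     exec w (If e c\<^sub>1 c\<^sub>2) s (ecost e + 1 + t) s'"
| exec_If_false:
    "aval w e s = Some 0 \<Longrightarrow> exec w c\<^sub>2 s t s' \<Longrightarrow>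
     exec w (If e c\<^sub>1 c\<^sub>2) s (ecost e + 1 + t) s'"
| exec_While_false:
    "aval w e s = Some 0 \<Longrightarrow> exec w (While e c) s (ecost e + 1) s"
| exec_While_true:
    "aval w e s = Some x \<Longrightarrow> x \<noteq> 0 \<Longrightarrow> exec w c s t\<^sub>1 s' \<Longrightarrow> exec w (While e c) s' t\<^sub>2 s'' \<Longrightarrow>
     exec w (While e c) s (ecost e + 1 + t\<^sub>1 + t\<^sub>2) s''"

inductive_cases exec_SkipE: "exec w Skip s t s'"
inductive_cases exec_AssignE: "exec w (Assign r e) s t s'"
inductive_cases exec_StoreE: "exec w (Store a e\<^sub>1 e\<^sub>2) s t s'"
inductive_cases exec_SeqE: "exec w (Seq c\<^sub>1 c\<^sub>2) s t s'"
inductive_cases exec_IfE: "exec w (If e c\<^sub>1 c\<^sub>2) s t s'"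
inductive_cases exec_WhileE: "exec w (While e c) s t s'"

lemma exec_deterministic:
  "exec w c s t s' \<Longrightarrow> exec w c s u s'' \<Longrightarrow> t = u \<and> s' = s''"
proof (induction arbitrary: u s'' rule: exec.induct)
  case exec_Skip
  then show ?case by (auto elim: exec_SkipE)
next
  case exec_Assign
  then show ?case by (auto elim!: exec_AssignE)
next
  case exec_Store
  then show ?case by (auto elim!: exec_StoreE)
next
  case exec_Seq
  from exec_Seq.prems show ?case
    by (rule exec_SeqE) (use exec_Seq.IH in blast)
next
  case (exec_If_true e s x c\<^sub>1 t s' c\<^sub>2)
  from exec_If_true.prems obtain u' where "exec w c\<^sub>1 s u' s''" "u = ecost e + 1 + u'"
    by (rule exec_IfE) (use exec_If_true.hyps in simp_all)
  then show ?case using exec_If_true.IH by blast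
next
  case (exec_If_false e s c\<^sub>2 t s' c\<^sub>1)
  from exec_If_false.prems obtain u' where "exec w c\<^sub>2 s u' s''" "u = ecost e + 1 + u'"
    by (rule exec_IfE) (use exec_If_false.hyps in simp_all)
  then show ?case using exec_If_false.IH by blast
next
  case (exec_While_false e s c)
  from exec_While_false.prems show ?case
    by (rule exec_WhileE) (use exec_While_false.hyps in simp_all)
next
  case (exec_While_true e s x c t\<^sub>1 s\<^sub>1 t\<^sub>2 s\<^sub>2)
  from exec_While_true.prems obtain u\<^sub>1 r u\<^sub>2
    where "exec w c s u\<^sub>1 r" "exec w (While e c) r u\<^sub>2 s''" "u = ecost e + 1 + u\<^sub>1 + u\<^sub>2"
    by (rule exec_WhileE) (use exec_While_true.hyps in simp_all)
  then show ?case using exec_While_true.IH by blast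
qed

text \<open>
  Input: a graph with vertex set \<open>{..<n}\<close>, given by \<open>n\<close> in register \<open>0\<close> and its adjacency matrix,
  row by row, in array \<open>0\<close>.
\<close>

definition input_state :: "nat \<Rightarrow> (nat, 'b) pre_digraph \<Rightarrow> state" where
  "input_state n G =
     \<lparr> regs = (\<lambda>r. if r = 0 then n else 0),
       arrs = (\<lambda>a i. if a = 0 \<and> i < n * n \<and> (i div n) \<rightarrow>\<^bsub>G\<^esub> (i mod n) then 1 else 0) \<rparr>"

text \<open>
  Output: register \<open>0\<close> holds \<open>0\<close> for the answer that \<open>G\<close> is not clique-Sperner; it holds \<open>1\<close> if
  a decomposition has been found, and then cell \<open>v\<close> of array \<open>1\<close> holds the index, from \<open>0\<close> to
  \<open>4\<close>, of the part among \<open>{z}, I\<^sub>1, I\<^sub>2, K\<^sub>1, K\<^sub>2\<close> that contains \<open>v\<close>.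
\<close>

definition output_part :: "nat \<Rightarrow> state \<Rightarrow> nat \<Rightarrow> nat set" where
  "output_part n s j = {v. v < n \<and> arrs s 1 v = j}"

definition correct_output :: "nat \<Rightarrow> (nat, 'b) pre_digraph \<Rightarrow> state \<Rightarrow> bool" where
  "correct_output n G s \<longleftrightarrow>
     regs s 0 = 0 \<and> \<not> clique_sperner G \<or>
     regs s 0 = 1 \<and>
       (\<exists>K I z I\<^sub>1 I\<^sub>2 K\<^sub>1 K\<^sub>2.
          {z} = output_part n s 0 \<and>
          I\<^sub>1 = output_part n s 1 \<and> I\<^sub>2 = output_part n s 2 \<and>
          K\<^sub>1 = output_part n s 3 \<and> K\<^sub>2 = output_part n s 4 \<and>
          labeled_clique_sperner G K I \<and>
          sperner_decomposition G K I z I\<^sub>1 I\<^sub>2 K\<^sub>1 K\<^sub>2)"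

end

theory Submission
  imports Defs
begin

text \<open>
  By \<open>H\<close>-freeness and the Sperner property, for any two vertices of \<open>K\<close> the smaller of the two
  differences of their neighbourhoods in \<open>I\<close> is a singleton. Take the largest neighbourhood \<open>C\<close> and
  a smallest one \<open>B\<close> among the others: then the only element \<open>z\<close> of \<open>B - C\<close> has the property that
  every other \<open>w\<close> in \<open>I\<close> either has no common neighbour with \<open>z\<close> or covers \<open>K\<close> together with \<open>z\<close>.
  The decomposition is read off from \<open>K\<^sub>1 = K \<inter> N(z)\<close>.

  For the algorithm, order the vertices by decreasing degree, breaking ties arbitrarily. If \<open>G\<close> is
  clique-Sperner, then the vertices whose rank (counted from \<open>0\<close>) is less than their degree form the
  clique of a clique-Sperner partition. So only one partition has to be checked, and then every
  vertex is tried as \<open>z\<close>, in cubic time.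
\<close>

section \<open>Induced subgraphs and the 1-Sperner property\<close>

text \<open>The existence of \<open>z\<close> depends only on the family of traces on
  \<open>I\<close> of the neighbourhoods of the clique vertices, so it is proved for set families,
  and graphs enter only through the bound on differences. The program does not follow that proof: it
  computes neither \<open>B\<close> nor \<open>C\<close>, but tests the wanted property of every
  candidate \<open>z\<close> directly. Deciding about one pair of vertices takes one scan of all
  vertices, so checking the partition and finding \<open>z\<close> both need three nested loops.
  \<open>H\<close>-freeness is never tested; it guarantees that the search succeeds. The delicate
  point is the guessed partition. A vertex of \<open>I\<close> can have as large a degree as one of
  \<open>K\<close> only if there is at most one edge. Moreover, a lone vertex taken as the clique
  leaves no room for \<open>z\<close>, so the guess has to put it into \<open>I\<close>.\<close>

lemma induce_adj: "u \<rightarrow>\<^bsub>G \<restriction> A\<^esub> v \<longleftrightarrow> u \<in> A \<and> v \<in> A \<and> u \<rightarrow>\<^bsub>G\<^esub> v"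
  by (auto simp: arcs_ends_conv)

lemma induce_induce: "S \<subseteq> A \<Longrightarrow> (G \<restriction> A) \<restriction> S = G \<restriction> S"
  by (auto simp: induce_subgraph_def)

lemma induced_free_induce:
  assumes "induced_free F G" "A \<subseteq> verts G"
  shows "induced_free F (G \<restriction> A)"
  using assms unfolding induced_free_def
  by (auto simp: induce_induce)

lemma dominates_commute:
  assumes "graph G"
  shows "x \<rightarrow>\<^bsub>G\<^esub> y \<longleftrightarrow> y \<rightarrow>\<^bsub>G\<^esub> x"
proof -
  interpret graph G by fact
  show ?thesis using sym_arcs by (auto simp: symmetric_def dest: symD)
qed

lemma not_dominates_self:
  assumes "graph G"
  shows "\<not> x \<rightarrow>\<^bsub>G\<^esub> x"
proof -
  interpret graph G by fact
  show ?thesis by (rule notI) (auto simp: arcs_ends_conv dest: no_loops)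
qed

text \<open>Isomorphisms of digraphs also map arcs. Without parallel arcs the arc map is forced by
  the vertex map, so an injection that preserves and reflects adjacency is enough; \<open>g\<close>
  selects the arc with the prescribed ends.\<close>

lemma digraph_iso_induceI:
  assumes "wf_digraph F" "nomulti_digraph F" "wf_digraph G" "nomulti_digraph G"
    and inj: "inj_on f (verts F)"
    and adj: "\<And>x y. x \<in> verts F \<Longrightarrow> y \<in> verts F \<Longrightarrow> f x \<rightarrow>\<^bsub>G\<^esub> f y \<longleftrightarrow> x \<rightarrow>\<^bsub>F\<^esub> y"
  shows "digraph_iso F (G \<restriction> f ` verts F)"
proof -
  interpret F: wf_digraph F by fact
  interpret F: nomulti_digraph F by fact
  interpret G: nomulti_digraph G by fact
  define g where "g e = (SOME a. a \<in> arcs G \<and> tail G a = f (tail F e) \<and> head G a = f (head F e))" for e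
  have g: "g e \<in> arcs G \<and> tail G (g e) = f (tail F e) \<and> head G (g e) = f (head F e)"
    if "e \<in> arcs F" for e
  proof -
    have "tail F e \<rightarrow>\<^bsub>F\<^esub> head F e"
      using that by (auto simp: arcs_ends_conv)
    then have "f (tail F e) \<rightarrow>\<^bsub>G\<^esub> f (head F e)"
      using that adj by auto
    then have "\<exists>a. a \<in> arcs G \<and> tail G a = f (tail F e) \<and> head G a = f (head F e)"
      unfolding arcs_ends_conv by force
    then show ?thesis
      unfolding g_def by (rule someI_ex)
  qed
  define iso where "iso = \<lparr>iso_verts = f, iso_arcs = g, iso_head = head G, iso_tail = tail G\<rparr>"
  have "inj_on g (arcs F)"
  proof (rule inj_onI)
    fix d e assume "d \<in> arcs F" "e \<in> arcs F" "g d = g e"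
    then have "f (tail F d) = f (tail F e)" "f (head F d) = f (head F e)"
      using g by metis+
    then show "d = e"
      using inj \<open>d \<in> arcs F\<close> \<open>e \<in> arcs F\<close>
      by (intro F.no_multi_arcs) (auto simp: arc_to_ends_def inj_on_eq_iff)
  qed
  then have "pre_digraph.digraph_isomorphism F iso"
    using g inj \<open>wf_digraph F\<close> by (simp add: pre_digraph.digraph_isomorphism_def iso_def)
  moreover have "g ` arcs F = {a \<in> arcs G. tail G a \<in> f ` verts F \<and> head G a \<in> f ` verts F}"
  proof (intro equalityI subsetI)
    fix a assume "a \<in> {a \<in> arcs G. tail G a \<in> f ` verts F \<and> head G a \<in> f ` verts F}"
    then obtain x y where xy: "a \<in> arcs G" "x \<in> verts F" "y \<in> verts F" "tail G a = f x" "head G a = f y"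
      by auto
    then have "x \<rightarrow>\<^bsub>F\<^esub> y"
      using adj[of x y] by (auto simp: arcs_ends_conv intro: rev_image_eqI)
    then obtain e where "e \<in> arcs F" "x = tail F e" "y = head F e"
      by (auto simp: arcs_ends_conv)
    then show "a \<in> g ` arcs F"
      using xy g[of e] G.no_multi_arcs[of a "g e"] by (auto simp: arc_to_ends_def)
  qed (use g in auto)
  ultimately show ?thesis
    unfolding digraph_iso_def by (intro exI[of _ iso]) (simp add: app_iso_def induce_subgraph_def iso_def)
qed

text \<open>Otherwise \<open>u\<close> and \<open>v\<close>, with two private neighbours each,
  induce \<open>H_graph\<close> with centers \<open>u\<close> and \<open>v\<close>.\<close>

lemma H_free_card_diff:
  assumes "graph G" "H_free G" "split_partition G K I" "u \<in> K" "v \<in> K" "u \<noteq> v"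
  shows "card (nbhd G u \<inter> I - nbhd G v \<inter> I) \<le> 1 \<or> card (nbhd G v \<inter> I - nbhd G u \<inter> I) \<le> 1"
proof (rule ccontr)
  assume "\<not> ?thesis"
  then have "2 \<le> card (nbhd G u \<inter> I - nbhd G v \<inter> I)" "2 \<le> card (nbhd G v \<inter> I - nbhd G u \<inter> I)"
    by auto
  then obtain a b c d where abcd: "a \<noteq> b" "c \<noteq> d"
    "{a, b} \<subseteq> nbhd G u \<inter> I - nbhd G v \<inter> I" "{c, d} \<subseteq> nbhd G v \<inter> I - nbhd G u \<inter> I"
    by (metis card_2_iff obtain_subset_with_card_n)
  interpret graph G by fact
  interpret H: graph H_graph by (rule graph_H_graph)
  note sym = dominates_commute[OF assms(1)]
  note irr = not_dominates_self[OF assms(1)]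
  have K: "u \<rightarrow>\<^bsub>G\<^esub> v" "v \<rightarrow>\<^bsub>G\<^esub> u" "{u, v} \<inter> I = {}"
    using assms unfolding split_partition_def is_clique_def by auto
  have I: "\<not> x \<rightarrow>\<^bsub>G\<^esub> y" if "x \<in> {a,b,c,d}" "y \<in> {a,b,c,d}" for x y
    using assms abcd that unfolding split_partition_def is_independent_def by auto
  have adj: "u \<rightarrow>\<^bsub>G\<^esub> a" "u \<rightarrow>\<^bsub>G\<^esub> b" "\<not> u \<rightarrow>\<^bsub>G\<^esub> c" "\<not> u \<rightarrow>\<^bsub>G\<^esub> d"
    "v \<rightarrow>\<^bsub>G\<^esub> c" "v \<rightarrow>\<^bsub>G\<^esub> d" "\<not> v \<rightarrow>\<^bsub>G\<^esub> a" "\<not> v \<rightarrow>\<^bsub>G\<^esub> b"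
    using abcd by (auto simp: nbhd_def)
  \<comment> \<open>The list follows the numbering of \<open>H_graph\<close>: centers at positions
    \<open>0\<close> and \<open>3\<close>, each followed by its leaves.\<close>
  define f :: "nat \<Rightarrow> 'a" where "f i = [u, a, b, v, c, d] ! i" for i
  have V: "verts H_graph = {0, 1, 2, 3, 4, 5}"
    by (simp add: H_graph_def Let_def)
  have f: "f 0 = u" "f (Suc 0) = a" "f 2 = b" "f 3 = v" "f 4 = c" "f 5 = d"
    by (simp_all add: f_def)
  have "distinct [u, a, b, v, c, d]"
    using K adj abcd irr assms by auto
  then have inj: "inj_on f (verts H_graph)"
    unfolding f_def[abs_def] by (rule inj_on_nth) (simp add: V)
  have "arcs_ends H_graph =
      {(1, 0), (0, 2), (4, 3), (3, 5), (0, 3)} \<union> {(1, 0), (0, 2), (4, 3), (3, 5), (0, 3)}\<inverse>"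
    by (simp only: H_graph_def Let_def with_proj_simps pair_pre_digraph.simps)
  also have "\<dots> = {(1, 0), (0, 2), (4, 3), (3, 5), (0, 3), (0, 1), (2, 0), (3, 4), (5, 3), (3, 0)}"
    by blast
  finally have E: "arcs_ends H_graph =
      {(1, 0), (0, 2), (4, 3), (3, 5), (0, 3), (0, 1), (2, 0), (3, 4), (5, 3), (3, 0)}" .
  have adj': "a \<rightarrow>\<^bsub>G\<^esub> u" "b \<rightarrow>\<^bsub>G\<^esub> u" "\<not> c \<rightarrow>\<^bsub>G\<^esub> u" "\<not> d \<rightarrow>\<^bsub>G\<^esub> u"
    "c \<rightarrow>\<^bsub>G\<^esub> v" "d \<rightarrow>\<^bsub>G\<^esub> v" "\<not> a \<rightarrow>\<^bsub>G\<^esub> v" "\<not> b \<rightarrow>\<^bsub>G\<^esub> v"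
    using adj sym by blast+
  have "f x \<rightarrow>\<^bsub>G\<^esub> f y \<longleftrightarrow> x \<rightarrow>\<^bsub>H_graph\<^esub> y" if "x \<in> verts H_graph" "y \<in> verts H_graph" for x y
    using that unfolding V E
    by (elim insertE emptyE; simp add: f adj adj' K(1,2) I irr)
  then have "digraph_iso H_graph (G \<restriction> f ` verts H_graph)"
    using inj by (intro digraph_iso_induceI H.wf_digraph_axioms H.nomulti_digraph_axioms
        wf_digraph_axioms nomulti_digraph_axioms)
  moreover have "f ` verts H_graph \<subseteq> verts G"
    using assms abcd by (auto simp: V f split_partition_def)
  ultimately show False
    using assms(2) unfolding induced_free_def by simp
qed

section \<open>The gluing vertex\<close>

text \<open>
  Let \<open>C\<close> be a largest set of the family and \<open>B\<close> a smallest one among the others. All other sets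
  meet the complement of \<open>C\<close> in one point; \<open>z\<close> is this point for \<open>B\<close>. Two sets with different
  such points have comparable traces on \<open>C\<close>, so a set through \<open>z\<close> that is not contained in
  another one off \<open>z\<close> would contain \<open>B\<close>.
\<close>

lemma one_sperner_gluing:
  fixes f :: "'k \<Rightarrow> 'i set"
  assumes fin: "finite K" "finite I" and I: "I \<noteq> {}" "\<And>u. u \<in> K \<Longrightarrow> f u \<subseteq> I"
    and sperner: "\<And>u v. u \<in> K \<Longrightarrow> v \<in> K \<Longrightarrow> f u \<subseteq> f v \<Longrightarrow> u = v"
    and one: "\<And>u v. u \<in> K \<Longrightarrow> v \<in> K \<Longrightarrow> u \<noteq> v \<Longrightarrow>
      card (f u - f v) \<le> 1 \<or> card (f v - f u) \<le> 1"
  shows "\<exists>z\<in>I. \<forall>w\<in>I. w \<noteq> z \<longrightarrow>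
    (\<forall>u\<in>K. \<not> (z \<in> f u \<and> w \<in> f u)) \<or> (\<forall>u\<in>K. z \<in> f u \<or> w \<in> f u)"
proof (cases "\<exists>c\<in>K. K \<noteq> {c}")
  \<comment> \<open>\<open>K\<close> has at most one element, so for every \<open>w\<close> one of
    the two alternatives holds, whatever \<open>z\<close> is.\<close>
  case False
  obtain z where "z \<in> I" using I by blast
  moreover have "u = v" if "u \<in> K" "v \<in> K" for u v
    using False that by blast
  ultimately show ?thesis by blast
next
  case True
  have finf: "finite (f u)" if "u \<in> K" for u
    using that I fin finite_subset by blast
  from True obtain k where "k \<in> K" by blast
  moreover have "card (f u) < Suc (card I)" if "u \<in> K" for u
    using that I fin by (simp add: card_mono less_Suc_eq_le)
  ultimately obtain c where c: "c \<in> K" "\<And>u. u \<in> K \<Longrightarrow> card (f u) \<le> card (f c)"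
    using Lattices_Big.ex_has_greatest_nat[of "\<lambda>u. u \<in> K" k "\<lambda>u. card (f u)"] by blast
  with True obtain k' where "k' \<in> K \<and> k' \<noteq> c" by blast
  then obtain b where b: "b \<in> K" "b \<noteq> c" "\<And>u. u \<in> K \<Longrightarrow> u \<noteq> c \<Longrightarrow> card (f b) \<le> card (f u)"
    using ex_has_least_nat[of "\<lambda>u. u \<in> K \<and> u \<noteq> c" k' "\<lambda>u. card (f u)"] by blast
  have eq: "x = y" if "finite X" "card X \<le> 1" "x \<in> X" "y \<in> X" for x y and X :: "'i set"
    using that by (simp add: card_le_Suc0_iff_eq)
  \<comment> \<open>Both differences arise by removing the same intersection, so the smaller set has
    the smaller difference; the Sperner property keeps it non-empty.\<close>
  have diff: "\<exists>x. f u - f v = {x}" if uv: "u \<in> K" "v \<in> K" "u \<noteq> v" "card (f u) \<le> card (f v)" for u v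
  proof -
    have "card (f u - f v) \<le> card (f v - f u)"
      using uv finf by (simp add: card_Diff_subset_Int card_mono Int_commute diff_le_mono)
    then have "card (f u - f v) \<le> 1"
      using one[of u v] uv by linarith
    moreover have "f u - f v \<noteq> {}"
      using sperner uv by blast
    ultimately show ?thesis
      using eq[of "f u - f v"] finf uv by blast
  qed
  obtain z where z: "f b - f c = {z}"
    using diff[of b c] b c by auto
  have "z \<in> I" using z b I by auto
  moreover have False
    if w: "w \<in> I" "w \<noteq> z" and u: "u \<in> K" "z \<in> f u" "w \<in> f u" and v: "v \<in> K" "z \<notin> f v" "w \<notin> f v" for u v w
  proof -
    have "u \<noteq> c" using u z by auto
    then obtain x where "f u - f c = {x}" using diff[OF u(1) c(1) _ c(2)[OF u(1)]] by blast
    moreover have "z \<in> f u - f c" using u z by blast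
    ultimately have uc: "f u - f c = {z}" by auto
    show False
    proof (cases "v = c")
      case True
      then show False using uc w u v by blast
    next
      case False
      then obtain x where x: "f v - f c = {x}"
        using diff[OF v(1) c(1) _ c(2)[OF v(1)]] by blast
      obtain y where "f b - f v = {y}"
        using diff[OF b(1) v(1) _ b(3)[OF v(1) False]] v z by blast
      moreover have "z \<in> f b - f v" using z v by blast
      ultimately have bv: "f b - f v = {z}" by auto
      \<comment> \<open>\<open>f u - f v\<close> contains both \<open>z\<close> and
        \<open>w\<close>, so \<open>f v - f u\<close> has at most one element, and \<open>x\<close>
        is such an element.\<close>
      have "\<not> card (f u - f v) \<le> 1"
        using eq[of "f u - f v" w z] w u v finf by blast
      then have "card (f v - f u) \<le> 1" using one u v by blast
      have xv: "x \<in> f v" "x \<notin> f c" "x \<noteq> z" using x v by auto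
      with uc have xu: "x \<notin> f u" by (metis DiffI singletonD)
      \<comment> \<open>A \<open>y\<close> missing from \<open>f u\<close> lies in
        \<open>f v\<close>, hence is \<open>x\<close>; but \<open>x\<close> is outside
        \<open>f c\<close>, where \<open>f b\<close> has only \<open>z\<close>. So
        \<open>b = u\<close>, and then \<open>w\<close> would be a second element of
        \<open>f b - f v\<close>.\<close>
      have "y \<in> f u" if y: "y \<in> f b" for y
      proof (rule ccontr)
        assume "y \<notin> f u"
        with y u bv have "y \<in> f v" by (metis DiffI singletonD)
        with \<open>y \<notin> f u\<close> xv xu have "y = x"
          using eq[OF _ \<open>card (f v - f u) \<le> 1\<close>, of y x] finf v by blast
        with y xv z show False by (metis DiffI singletonD)
      qed
      then have "b = u" using sperner b u by blast
      then show False using bv u v w by (metis DiffI singletonD)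
    qed
  qed
  ultimately show ?thesis by blast
qed

section \<open>From a gluing vertex to the decomposition\<close>

lemma sperner_decompositionI:
  assumes G: "graph G" "H_free G" and L: "labeled_clique_sperner G K I"
    and K: "K\<^sub>1 = K \<inter> nbhd G z" "K\<^sub>2 = K - nbhd G z"
    and I: "I = {z} \<union> I\<^sub>1 \<union> I\<^sub>2" "z \<notin> I\<^sub>1" "z \<notin> I\<^sub>2" "I\<^sub>1 \<inter> I\<^sub>2 = {}"
    and I1: "\<And>w u. w \<in> I\<^sub>1 \<Longrightarrow> u \<in> K\<^sub>2 \<Longrightarrow> w \<rightarrow>\<^bsub>G\<^esub> u"
    and I2: "\<And>w u. w \<in> I\<^sub>2 \<Longrightarrow> u \<in> K\<^sub>1 \<Longrightarrow> \<not> w \<rightarrow>\<^bsub>G\<^esub> u"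
  shows "sperner_decomposition G K I z I\<^sub>1 I\<^sub>2 K\<^sub>1 K\<^sub>2"
proof -
  note sym = dominates_commute[OF G(1)]
  from L have "split_partition G K I"
    and S: "\<And>u v. u \<in> K \<Longrightarrow> v \<in> K \<Longrightarrow> nbhd G u \<inter> I \<subseteq> nbhd G v \<inter> I \<Longrightarrow> u = v"
    by (auto simp: labeled_clique_sperner_def)
  then have V: "verts G = K \<union> I" "K \<inter> I = {}"
    and cl: "\<And>u v. u \<in> K \<Longrightarrow> v \<in> K \<Longrightarrow> u \<noteq> v \<Longrightarrow> u \<rightarrow>\<^bsub>G\<^esub> v"
    and ind: "\<And>u v. u \<in> I \<Longrightarrow> v \<in> I \<Longrightarrow> \<not> u \<rightarrow>\<^bsub>G\<^esub> v"
    unfolding split_partition_def is_clique_def is_independent_def by blast+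
  have sperner: "u = v" if "u \<in> K" "v \<in> K" "\<And>w. w \<in> I \<Longrightarrow> u \<rightarrow>\<^bsub>G\<^esub> w \<Longrightarrow> v \<rightarrow>\<^bsub>G\<^esub> w" for u v
    using that by (intro S) (auto simp: nbhd_def)
  have zK: "u \<in> K\<^sub>1 \<Longrightarrow> z \<rightarrow>\<^bsub>G\<^esub> u" "u \<in> K\<^sub>2 \<Longrightarrow> \<not> z \<rightarrow>\<^bsub>G\<^esub> u" for u
    using K by (auto simp: nbhd_def)
  \<comment> \<open>Unfolding both indices gives 25 blocks of the matrix, each settled by one of the
    facts collected in \<open>E\<close>.\<close>
  have all5: "(\<forall>i<Suc (Suc (Suc (Suc (Suc 0)))). P i) \<longleftrightarrow>
      P 0 \<and> P (Suc 0) \<and> P (Suc (Suc 0)) \<and> P (Suc (Suc (Suc 0))) \<and> P (Suc (Suc (Suc (Suc 0))))" for P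
    by (auto simp: All_less_Suc)
  have KK: "u \<in> K" if "u \<in> K\<^sub>1 \<or> u \<in> K\<^sub>2" for u using that K by auto
  have II: "w \<in> I" if "w = z \<or> w \<in> I\<^sub>1 \<or> w \<in> I\<^sub>2" for w using that I by auto
  have disj: "K\<^sub>1 \<inter> K\<^sub>2 = {}" "(K\<^sub>1 \<union> K\<^sub>2) \<inter> ({z} \<union> I\<^sub>1 \<union> I\<^sub>2) = {}" and KU: "K = K\<^sub>1 \<union> K\<^sub>2"
    using K I V by auto
  have zN: "z \<notin> K\<^sub>1" "z \<notin> K\<^sub>2" and dj: "K\<^sub>1 \<inter> I\<^sub>1 = {}" "K\<^sub>1 \<inter> I\<^sub>2 = {}" "K\<^sub>2 \<inter> I\<^sub>1 = {}" "K\<^sub>2 \<inter> I\<^sub>2 = {}"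
    "I\<^sub>1 \<inter> K\<^sub>1 = {}" "I\<^sub>2 \<inter> K\<^sub>1 = {}" "I\<^sub>1 \<inter> K\<^sub>2 = {}" "I\<^sub>2 \<inter> K\<^sub>2 = {}" "K\<^sub>1 \<inter> K\<^sub>2 = {}" "K\<^sub>2 \<inter> K\<^sub>1 = {}" "I\<^sub>2 \<inter> I\<^sub>1 = {}"
    using disj I by auto
  have E1: "\<not> u \<rightarrow>\<^bsub>G\<^esub> v" if "u = z \<or> u \<in> I\<^sub>1 \<or> u \<in> I\<^sub>2" "v = z \<or> v \<in> I\<^sub>1 \<or> v \<in> I\<^sub>2" for u v
    using ind II that by blast
  have E2: "u \<rightarrow>\<^bsub>G\<^esub> v" if "u \<in> K\<^sub>1 \<or> u \<in> K\<^sub>2" "v \<in> K\<^sub>1 \<or> v \<in> K\<^sub>2" "u \<noteq> v" for u v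
    using cl KK that by blast
  have E3: "w \<in> I\<^sub>1 \<Longrightarrow> u \<in> K\<^sub>2 \<Longrightarrow> u \<rightarrow>\<^bsub>G\<^esub> w" "w \<in> I\<^sub>2 \<Longrightarrow> u \<in> K\<^sub>1 \<Longrightarrow> \<not> u \<rightarrow>\<^bsub>G\<^esub> w"
    "u \<in> K\<^sub>1 \<Longrightarrow> u \<rightarrow>\<^bsub>G\<^esub> z" "u \<in> K\<^sub>2 \<Longrightarrow> \<not> u \<rightarrow>\<^bsub>G\<^esub> z" for u w
    using I1 I2 zK sym by blast+
  note E = E1 E2 E3 zK I1 I2
  have "M_partition (M_matrix Zero One) G [{z}, I\<^sub>1, I\<^sub>2, K\<^sub>1, K\<^sub>2]"
    unfolding M_partition_def
  proof (intro conjI)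
    show "\<Union> (set [{z}, I\<^sub>1, I\<^sub>2, K\<^sub>1, K\<^sub>2]) = verts G"
      using V I KU by auto
    show "\<forall>i<length [{z}, I\<^sub>1, I\<^sub>2, K\<^sub>1, K\<^sub>2]. \<forall>j<length [{z}, I\<^sub>1, I\<^sub>2, K\<^sub>1, K\<^sub>2]. i \<noteq> j \<longrightarrow>
      [{z}, I\<^sub>1, I\<^sub>2, K\<^sub>1, K\<^sub>2] ! i \<inter> [{z}, I\<^sub>1, I\<^sub>2, K\<^sub>1, K\<^sub>2] ! j = {}"
      using I zN dj by (simp add: all5)
    show "\<forall>i<length [{z}, I\<^sub>1, I\<^sub>2, K\<^sub>1, K\<^sub>2]. \<forall>j<length [{z}, I\<^sub>1, I\<^sub>2, K\<^sub>1, K\<^sub>2].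
      \<forall>u\<in>[{z}, I\<^sub>1, I\<^sub>2, K\<^sub>1, K\<^sub>2] ! i. \<forall>v\<in>[{z}, I\<^sub>1, I\<^sub>2, K\<^sub>1, K\<^sub>2] ! j. u \<noteq> v \<longrightarrow>
      (M_matrix Zero One ! i ! j = One \<longrightarrow> u \<rightarrow>\<^bsub>G\<^esub> v) \<and>
      (M_matrix Zero One ! i ! j = Zero \<longrightarrow> \<not> u \<rightarrow>\<^bsub>G\<^esub> v)"
      by (simp add: all5 M_matrix_def, intro conjI ballI impI; simp add: E)
  qed (simp add: M_matrix_def)
  \<comment> \<open>All vertices of \<open>K\<^sub>1\<close> see \<open>z\<close> and none sees
    \<open>I\<^sub>2\<close>, so their traces on \<open>I\<close> differ only within
    \<open>I\<^sub>1\<close>. Dually, vertices of \<open>K\<^sub>2\<close> miss \<open>z\<close> and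
    see all of \<open>I\<^sub>1\<close>.\<close>
  moreover have "labeled_clique_sperner (G \<restriction> (K\<^sub>1 \<union> I\<^sub>1)) K\<^sub>1 I\<^sub>1"
  proof -
    have "u = v" if "u \<in> K\<^sub>1" "v \<in> K\<^sub>1" "\<And>w. w \<in> I\<^sub>1 \<Longrightarrow> u \<rightarrow>\<^bsub>G\<^esub> w \<Longrightarrow> v \<rightarrow>\<^bsub>G\<^esub> w" for u v
      using that zK I2 sym I by (intro sperner KK) blast+
    then show ?thesis
      using disj cl[OF KK KK] ind[OF II II]
      unfolding labeled_clique_sperner_def split_partition_def is_clique_def is_independent_def nbhd_def induce_adj
      by auto
  qed
  moreover have "labeled_clique_sperner (G \<restriction> (K\<^sub>2 \<union> I\<^sub>2)) K\<^sub>2 I\<^sub>2"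
  proof -
    have "u = v" if "u \<in> K\<^sub>2" "v \<in> K\<^sub>2" "\<And>w. w \<in> I\<^sub>2 \<Longrightarrow> u \<rightarrow>\<^bsub>G\<^esub> w \<Longrightarrow> v \<rightarrow>\<^bsub>G\<^esub> w" for u v
      using that zK I1 sym I by (intro sperner KK) blast+
    then show ?thesis
      using disj cl[OF KK KK] ind[OF II II]
      unfolding labeled_clique_sperner_def split_partition_def is_clique_def is_independent_def nbhd_def induce_adj
      by auto
  qed
  moreover have "H_free (G \<restriction> (K\<^sub>1 \<union> I\<^sub>1))" "H_free (G \<restriction> (K\<^sub>2 \<union> I\<^sub>2))"
    using G V KU I by (auto intro!: induced_free_induce)
  ultimately show ?thesis
    using I KU disj unfolding sperner_decomposition_def by blast
qed

lemma ex_gluing_vertex: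
  assumes G: "graph G" "H_free G" and L: "labeled_clique_sperner G K I" and "I \<noteq> {}"
  shows "\<exists>z\<in>I. \<forall>w\<in>I. w \<noteq> z \<longrightarrow>
    (\<forall>u\<in>K. \<not> (z \<rightarrow>\<^bsub>G\<^esub> u \<and> w \<rightarrow>\<^bsub>G\<^esub> u)) \<or> (\<forall>u\<in>K. z \<rightarrow>\<^bsub>G\<^esub> u \<or> w \<rightarrow>\<^bsub>G\<^esub> u)"
proof -
  interpret graph G by (rule G)
  note sym = dominates_commute[OF G(1)]
  from L have P: "split_partition G K I" and
    sp: "\<And>u v. u \<in> K \<Longrightarrow> v \<in> K \<Longrightarrow> nbhd G u \<inter> I \<subseteq> nbhd G v \<inter> I \<Longrightarrow> u = v"
    by (auto simp: labeled_clique_sperner_def)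
  have "finite K" "finite I"
    using P finite_verts by (auto simp: split_partition_def)
  from one_sperner_gluing[where f = "\<lambda>u. nbhd G u \<inter> I", OF this \<open>I \<noteq> {}\<close> Int_lower2 sp
      H_free_card_diff[OF G P]]
  show ?thesis by (simp add: nbhd_def sym[of _ "_ :: 'a"])
qed

lemma ex_sperner_decomposition:
  assumes G: "graph G" "H_free G" and L: "labeled_clique_sperner G K I" and "I \<noteq> {}"
  shows "\<exists>z I\<^sub>1 I\<^sub>2 K\<^sub>1 K\<^sub>2. sperner_decomposition G K I z I\<^sub>1 I\<^sub>2 K\<^sub>1 K\<^sub>2"
proof -
  obtain z where z: "z \<in> I" "\<And>w. w \<in> I \<Longrightarrow> w \<noteq> z \<Longrightarrow>
      (\<forall>u\<in>K. \<not> (z \<rightarrow>\<^bsub>G\<^esub> u \<and> w \<rightarrow>\<^bsub>G\<^esub> u)) \<or> (\<forall>u\<in>K. z \<rightarrow>\<^bsub>G\<^esub> u \<or> w \<rightarrow>\<^bsub>G\<^esub> u)"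
    using ex_gluing_vertex[OF assms] by blast
  \<comment> \<open>Vertices satisfying both alternatives go to \<open>I\<^sub>2\<close>; the rest
    satisfy the second one, so they see every clique vertex that \<open>z\<close> misses.\<close>
  define I\<^sub>2 where "I\<^sub>2 = {w \<in> I - {z}. \<forall>u\<in>K. \<not> (z \<rightarrow>\<^bsub>G\<^esub> u \<and> w \<rightarrow>\<^bsub>G\<^esub> u)}"
  have "sperner_decomposition G K I z (I - {z} - I\<^sub>2) I\<^sub>2 (K \<inter> nbhd G z) (K - nbhd G z)"
    using z by (intro sperner_decompositionI[OF G L]) (auto simp: I\<^sub>2_def nbhd_def)
  then show ?thesis by blast
qed

text \<open>If \<open>I\<close> is empty, all traces are empty and the Sperner property leaves at
  most one vertex in \<open>K\<close>.\<close>

lemma labeled_clique_sperner_indep_nonempty: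
  assumes "labeled_clique_sperner G K I" "card (verts G) \<ge> 2"
  shows "I \<noteq> {}"
proof
  assume "I = {}"
  with assms(1) have V: "verts G = K" and "\<And>u v. u \<in> K \<Longrightarrow> v \<in> K \<Longrightarrow> u = v"
    by (auto simp: labeled_clique_sperner_def split_partition_def)
  then have "card K \<le> 1"
    by (metis One_nat_def card.infinite card_le_Suc0_iff_eq zero_le)
  with V assms(2) show False by simp
qed

section \<open>The clique as a set of vertices of large degree\<close>

definition degree :: "nat \<Rightarrow> (nat \<Rightarrow> nat \<Rightarrow> bool) \<Rightarrow> nat \<Rightarrow> nat" where
  "degree n E u = card {v. v < n \<and> E u v}"

text \<open>A lexicographic order packed into one number: larger degree first, then smaller vertex.
  For \<open>u < n\<close> the second summand lies between \<open>1\<close> and \<open>n\<close>,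
  which keeps different degrees strictly apart.\<close>

definition key :: "nat \<Rightarrow> (nat \<Rightarrow> nat \<Rightarrow> bool) \<Rightarrow> nat \<Rightarrow> nat" where
  "key n E u = degree n E u * n + (n - u)"

definition top_set :: "nat \<Rightarrow> (nat \<Rightarrow> nat \<Rightarrow> bool) \<Rightarrow> nat set" where
  "top_set n E = {u. u < n \<and> card {v. v < n \<and> key n E u < key n E v} < degree n E u}"

lemma key_less_if_degree_less:
  assumes "v < n" "degree n E u < degree n E v"
  shows "key n E u < key n E v"
proof -
  have "key n E u \<le> Suc (degree n E u) * n" by (simp add: key_def)
  also have "\<dots> \<le> degree n E v * n" using assms by (intro mult_le_mono1) simp
  also have "\<dots> < key n E v" using assms by (simp add: key_def)
  finally show ?thesis .
qed

lemma key_inj: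
  assumes "u < n" "v < n" "key n E u = key n E v"
  shows "u = v"
proof -
  have "degree n E u = degree n E v"
    using assms key_less_if_degree_less by (metis less_irrefl nat_neq_iff)
  with assms show ?thesis by (simp add: key_def)
qed

text \<open>The gap ranks all of \<open>K\<close> before \<open>I\<close>. Hence ranks in
  \<open>K\<close> are below \<open>card K\<close>, and so below the degree, while ranks in
  \<open>I\<close> are at least \<open>card K\<close>.\<close>

lemma top_set_eqI:
  assumes K: "K \<union> I = {..<n}" "K \<inter> I = {}"
    and gap: "\<And>u w. u \<in> K \<Longrightarrow> w \<in> I \<Longrightarrow> degree n E w < degree n E u"
    and deg: "\<And>u. u \<in> K \<Longrightarrow> card K \<le> degree n E u" "\<And>w. w \<in> I \<Longrightarrow> degree n E w \<le> card K"
  shows "top_set n E = K"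
proof -
  have fin: "finite K" using K by (metis finite_Un finite_lessThan)
  have "u \<in> top_set n E" if u: "u \<in> K" for u
  proof -
    have "u < n" using u K by auto
    have "v \<in> K - {u}" if v: "v < n" "key n E u < key n E v" for v
    proof -
      have "v \<notin> I" using v gap[OF u] key_less_if_degree_less[OF \<open>u < n\<close>] by fastforce
      then show ?thesis using v K by auto
    qed
    then have "card {v. v < n \<and> key n E u < key n E v} \<le> card (K - {u})"
      using fin by (intro card_mono) auto
    also have "\<dots> < card K" using card_Diff1_less[OF fin u] .
    finally show ?thesis using deg u \<open>u < n\<close> by (fastforce simp: top_set_def)
  qed
  moreover have "w \<notin> top_set n E" if w: "w \<in> I" for w
  proof -
    have "card K \<le> card {v. v < n \<and> key n E w < key n E v}"
    proof (intro card_mono subsetI)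
      fix x assume "x \<in> K"
      with K w gap show "x \<in> {v. v < n \<and> key n E w < key n E v}"
        using key_less_if_degree_less[of x n E w] by auto
    qed simp
    with deg w show ?thesis by (fastforce simp: top_set_def)
  qed
  ultimately show ?thesis using K by (auto simp: top_set_def)
qed

text \<open>
  If \<open>|K| \<ge> 2\<close>, then vertices of \<open>K\<close> have degree at least \<open>|K|\<close> and those of \<open>I\<close> at most \<open>|K|\<close>,
  and the value \<open>|K|\<close> is not attained in both. The same holds for the center of a star with two
  leaves or more. In the remaining cases \<open>G\<close> has at most one edge, and \<open>K\<close> may have to be replaced.
\<close>

lemma labeled_clique_sperner_top_set:
  assumes G: "graph G" "verts G = {..<n}" and "clique_sperner G"
  shows "labeled_clique_sperner G (top_set n (dominates G)) ({..<n} - top_set n (dominates G))"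
proof -
  interpret graph G by (rule G)
  let ?d = "degree n (dominates G)" and ?k = "key n (dominates G)" and ?T = "top_set n (dominates G)"
  note sym = dominates_commute[OF G(1)]
  have ver: "y < n" if "x \<rightarrow>\<^bsub>G\<^esub> y" for x y
    using that G(2) by (metis adj_in_verts(2) lessThan_iff)
  obtain K I where L: "labeled_clique_sperner G K I"
    using assms(3) by (auto simp: clique_sperner_def)
  then have P: "split_partition G K I"
    and S: "\<And>u v. u \<in> K \<Longrightarrow> v \<in> K \<Longrightarrow> nbhd G u \<inter> I \<subseteq> nbhd G v \<inter> I \<Longrightarrow> u = v"
    by (auto simp: labeled_clique_sperner_def)
  from P G(2) have V: "K \<union> I = {..<n}" "K \<inter> I = {}"
    and cl: "\<And>u v. u \<in> K \<Longrightarrow> v \<in> K \<Longrightarrow> u \<noteq> v \<Longrightarrow> u \<rightarrow>\<^bsub>G\<^esub> v"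
    and ind: "\<And>u v. u \<in> I \<Longrightarrow> v \<in> I \<Longrightarrow> \<not> u \<rightarrow>\<^bsub>G\<^esub> v"
    by (simp_all add: split_partition_def is_clique_def is_independent_def)
  have fin: "finite K" using V by (metis finite_Un finite_lessThan)
  have d_ge: "card X \<le> ?d u" if "\<And>x. x \<in> X \<Longrightarrow> u \<rightarrow>\<^bsub>G\<^esub> x" for u X
    unfolding degree_def using that ver by (intro card_mono) auto
  have nw: "{v. v < n \<and> w \<rightarrow>\<^bsub>G\<^esub> v} \<subseteq> K" if "w \<in> I" for w
    using V ind that by auto
  then have dI: "?d w \<le> card K" if "w \<in> I" for w
    unfolding degree_def using that fin by (intro card_mono) auto
  have nu: "x \<rightarrow>\<^bsub>G\<^esub> y \<Longrightarrow> x \<in> K \<or> y \<in> K" for x y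
    using ind V ver[of x y] ver[of y x] sym by auto
  consider (big) "2 \<le> card K" | (one) u where "K = {u}" "2 \<le> ?d u" | (small) u where "K \<subseteq> {u}" "?d u \<le> 1"
  proof (cases "K = {}")
    case True
    then have "\<not> x \<rightarrow>\<^bsub>G\<^esub> y" for x y using nu by auto
    \<comment> \<open>An empty clique fits any \<open>u\<close>; without edges \<open>0\<close> is a
      valid choice.\<close>
    then have "?d 0 \<le> 1" by (simp add: degree_def)
    with True small show ?thesis by blast
  next
    case False
    then show ?thesis using that fin
      by (metis One_nat_def Suc_leI card_1_singletonE card_gt_0_iff le_neq_implies_less nat_le_linear
          not_less_eq_eq numeral_2_eq_2 order_refl)
  qed
  then show ?thesis
  proof cases
    case big
    have "card K \<le> ?d u \<and> (\<forall>w\<in>I. ?d w < ?d u)" if u: "u \<in> K" for u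
    proof -
      obtain v where v: "v \<in> K" "v \<noteq> u"
        using big u by (metis One_nat_def card_1_singleton_iff is_singletonI' is_singleton_def
            not_less_eq_eq numeral_2_eq_2 order_refl empty_iff)
      then obtain x where x: "x \<in> I" "u \<rightarrow>\<^bsub>G\<^esub> x" "\<not> v \<rightarrow>\<^bsub>G\<^esub> x"
        using S[OF u v(1)] by (auto simp: nbhd_def)
      have "x \<notin> K" using x V by auto
      \<comment> \<open>\<open>u\<close> sees the other clique vertices and its private neighbour
        \<open>x\<close>.\<close>
      have "card K = card (insert x (K - {u}))"
        using card.remove[OF fin u] u fin \<open>x \<notin> K\<close> by simp
      also have "\<dots> \<le> ?d u"
        using x cl u by (intro d_ge) auto
      finally have dK: "card K \<le> ?d u" .
      have "?d w < ?d u" if w: "w \<in> I" for w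
      proof (cases "?d w = card K")
        case False
        with dK dI[OF w] show ?thesis by linarith
      next
        case True
        then have "{v. v < n \<and> w \<rightarrow>\<^bsub>G\<^esub> v} = K"
          using card_subset_eq[OF fin nw[OF w]] by (simp add: degree_def)
        then have wa: "w \<rightarrow>\<^bsub>G\<^esub> y" if "y \<in> K" for y using that by blast
        then have "w \<noteq> x" using x v sym by blast
        have "w \<notin> K" using w V by auto
        \<comment> \<open>A \<open>w\<close> that attains \<open>card K\<close> sees the whole
          clique, so it differs from \<open>x\<close> and is one more neighbour of
          \<open>u\<close>.\<close>
        have "Suc (card K) = card (insert w (insert x (K - {u})))"
          using card.remove[OF fin u] u fin \<open>x \<notin> K\<close> \<open>w \<notin> K\<close> \<open>w \<noteq> x\<close> by simp
        also have "\<dots> \<le> ?d u"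
          using x cl u wa sym by (intro d_ge) auto
        finally show ?thesis using True by simp
      qed
      with dK show ?thesis by blast
    qed
    then have "?T = K" using V dI by (intro top_set_eqI) auto
    moreover have "{..<n} - K = I" using V by auto
    ultimately show ?thesis using L by simp
  next
    case one
    then have "?T = K" using V dI by (intro top_set_eqI[of K I]) fastforce+
    moreover have "{..<n} - K = I" using V by auto
    ultimately show ?thesis using L by simp
  next
    case small
    have nu1: "x = y" if "u \<rightarrow>\<^bsub>G\<^esub> x" "u \<rightarrow>\<^bsub>G\<^esub> y" for x y
      using small(2) that ver by (auto simp: degree_def card_le_Suc0_iff_eq)
    have touch: "x = u \<or> y = u" if "x \<rightarrow>\<^bsub>G\<^esub> y" for x y
      using nu[OF that] small by auto
    have d1: "?d v \<le> 1" for v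
    proof -
      have "a = b" if "v \<rightarrow>\<^bsub>G\<^esub> a" "v \<rightarrow>\<^bsub>G\<^esub> b" for a b
        using nu1 that touch[OF that(1)] touch[OF that(2)] by blast
      then show ?thesis by (auto simp: degree_def card_le_Suc0_iff_eq)
    qed
    \<comment> \<open>There is at most one edge, so a vertex of positive degree is one of its
      ends.\<close>
    have edge: "v = x \<or> v = y" if "x \<rightarrow>\<^bsub>G\<^esub> y" "?d v \<noteq> 0" for x y v
    proof -
      obtain v' where "v \<rightarrow>\<^bsub>G\<^esub> v'"
        using \<open>?d v \<noteq> 0\<close> by (auto simp: degree_def card_eq_0_iff)
      then have v: "v = u \<or> u \<rightarrow>\<^bsub>G\<^esub> v" using touch sym by metis
      have xy: "x = u \<and> u \<rightarrow>\<^bsub>G\<^esub> y \<or> y = u \<and> u \<rightarrow>\<^bsub>G\<^esub> x" using touch[OF that(1)] that(1) sym by metis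
      from v show ?thesis
      proof
        assume "v = u"
        with xy show ?thesis by metis
      next
        assume "u \<rightarrow>\<^bsub>G\<^esub> v"
        with xy nu1[OF this] show ?thesis by metis
      qed
    qed
    \<comment> \<open>With degrees at most \<open>1\<close>, only rank \<open>0\<close> qualifies,
      and keys are distinct.\<close>
    have "x = y" if "x \<in> ?T" "y \<in> ?T" for x y
    proof -
      have max: "\<not> ?k t < ?k v" if "t \<in> ?T" "v < n" for t v
      proof -
        have "card {v. v < n \<and> ?k t < ?k v} < ?d t" using that by (simp add: top_set_def)
        with d1[of t] have "card {v. v < n \<and> ?k t < ?k v} = 0" by linarith
        then have "{v. v < n \<and> ?k t < ?k v} = {}" by simp
        with that show ?thesis by blast
      qed
      have "x < n" "y < n" using that by (auto simp: top_set_def)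
      moreover have "?k x = ?k y"
        using max[OF that(1) \<open>y < n\<close>] max[OF that(2) \<open>x < n\<close>] by linarith
      ultimately show ?thesis by (rule key_inj)
    qed
    moreover have False if "x \<notin> ?T" "y \<notin> ?T" "x \<rightarrow>\<^bsub>G\<^esub> y" for x y
    proof -
      \<comment> \<open>An end of the edge outside \<open>?T\<close> has a larger key above it,
        necessarily that of the other end. For both ends at once this is circular.\<close>
      have above: "?k a < ?k b" if a: "a \<notin> ?T" and ab: "a \<rightarrow>\<^bsub>G\<^esub> b" for a b
      proof -
        have "a < n" using ab ver sym by blast
        have "1 \<le> ?d a" using d_ge[of "{b}" a] ab by simp
        moreover have "\<not> card {v. v < n \<and> ?k a < ?k v} < ?d a"
          using a \<open>a < n\<close> by (simp add: top_set_def)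
        ultimately have "card {v. v < n \<and> ?k a < ?k v} \<noteq> 0" by linarith
        then have "{v. v < n \<and> ?k a < ?k v} \<noteq> {}" by (metis card.empty)
        then obtain v where v: "v < n" "?k a < ?k v" by blast
        have "\<not> ?d v < ?d a"
          using key_less_if_degree_less[OF \<open>a < n\<close>, of "dominates G" v] v by linarith
        with \<open>1 \<le> ?d a\<close> have "?d v \<noteq> 0" by linarith
        with edge[OF ab] v show ?thesis by blast
      qed
      have "y \<rightarrow>\<^bsub>G\<^esub> x" using sym that(3) by blast
      with above[of x y] above[of y x] that show False by linarith
    qed
    moreover have "?T \<subseteq> {..<n}" by (auto simp: top_set_def)
    ultimately show ?thesis using G
      unfolding labeled_clique_sperner_def split_partition_def is_clique_def is_independent_def
      by blast
  qed
qed

text \<open>The form that a double loop over pairs with an inner scan can test.\<close>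

lemma labeled_clique_sperner_iff:
  assumes "graph G" "verts G = {..<n}" "K \<subseteq> {..<n}"
  shows "labeled_clique_sperner G K ({..<n} - K) \<longleftrightarrow>
    (\<forall>u<n. \<forall>v<n. (u \<in> K \<and> v \<in> K \<and> u \<noteq> v \<longrightarrow>
        u \<rightarrow>\<^bsub>G\<^esub> v \<and> (\<exists>w<n. w \<notin> K \<and> u \<rightarrow>\<^bsub>G\<^esub> w \<and> \<not> v \<rightarrow>\<^bsub>G\<^esub> w)) \<and>
      (u \<notin> K \<and> v \<notin> K \<longrightarrow> \<not> u \<rightarrow>\<^bsub>G\<^esub> v))"
proof -
  have "(\<forall>u\<in>K. \<forall>v\<in>K. nbhd G u \<inter> ({..<n} - K) \<subseteq> nbhd G v \<inter> ({..<n} - K) \<longrightarrow> u = v) \<longleftrightarrow>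
    (\<forall>u<n. \<forall>v<n. u \<in> K \<and> v \<in> K \<and> u \<noteq> v \<longrightarrow> (\<exists>w<n. w \<notin> K \<and> u \<rightarrow>\<^bsub>G\<^esub> w \<and> \<not> v \<rightarrow>\<^bsub>G\<^esub> w))"
    using assms(3) unfolding nbhd_def by blast
  then show ?thesis
    using assms(2,3) unfolding labeled_clique_sperner_def split_partition_def is_clique_def is_independent_def
    by auto blast+
qed

section \<open>Total correctness and running times of programs\<close>

primrec val :: "exp \<Rightarrow> state \<Rightarrow> nat" where
  "val (Const c) s = c"
| "val (Reg r) s = regs s r"
| "val (Load a e) s = arrs s a (val e s)"
| "val (Add e\<^sub>1 e\<^sub>2) s = val e\<^sub>1 s + val e\<^sub>2 s"
| "val (Sub e\<^sub>1 e\<^sub>2) s = val e\<^sub>1 s - val e\<^sub>2 s"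
| "val (Mul e\<^sub>1 e\<^sub>2) s = val e\<^sub>1 s * val e\<^sub>2 s"
| "val (Lt e\<^sub>1 e\<^sub>2) s = of_bool (val e\<^sub>1 s < val e\<^sub>2 s)"

text \<open>Separating overflow from the value replaces the option monad of \<open>aval\<close> by
  plain arithmetic side conditions.\<close>

primrec fits :: "nat \<Rightarrow> exp \<Rightarrow> state \<Rightarrow> bool" where
  "fits w (Const c) s \<longleftrightarrow> c \<le> w"
| "fits w (Reg r) s \<longleftrightarrow> regs s r \<le> w"
| "fits w (Load a e) s \<longleftrightarrow> fits w e s \<and> arrs s a (val e s) \<le> w"
| "fits w (Add e\<^sub>1 e\<^sub>2) s \<longleftrightarrow> fits w e\<^sub>1 s \<and> fits w e\<^sub>2 s \<and> val e\<^sub>1 s + val e\<^sub>2 s \<le> w"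
| "fits w (Sub e\<^sub>1 e\<^sub>2) s \<longleftrightarrow> fits w e\<^sub>1 s \<and> fits w e\<^sub>2 s"
| "fits w (Mul e\<^sub>1 e\<^sub>2) s \<longleftrightarrow> fits w e\<^sub>1 s \<and> fits w e\<^sub>2 s \<and> val e\<^sub>1 s * val e\<^sub>2 s \<le> w"
| "fits w (Lt e\<^sub>1 e\<^sub>2) s \<longleftrightarrow> fits w e\<^sub>1 s \<and> fits w e\<^sub>2 s \<and> 1 \<le> w"

lemma fits_val_le: "fits w e s \<Longrightarrow> val e s \<le> w"
  by (induction e) auto

lemma aval_fits: "fits w e s \<Longrightarrow> aval w e s = Some (val e s)"
  by (induction e) (auto simp: word_def intro: order_trans[OF diff_le_self fits_val_le])

definition Neg :: "exp \<Rightarrow> exp" where "Neg e = Lt e (Const 1)"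
definition Conj :: "exp \<Rightarrow> exp \<Rightarrow> exp" where "Conj a b = Neg (Add (Neg a) (Neg b))"
definition Disj :: "exp \<Rightarrow> exp \<Rightarrow> exp" where "Disj a b = Neg (Conj (Neg a) (Neg b))"
definition Neq :: "exp \<Rightarrow> exp \<Rightarrow> exp" where "Neq a b = Disj (Lt a b) (Lt b a)"

lemma val_connectives [simp]:
  "val (Neg e) s = of_bool (val e s = 0)"
  "val (Conj a b) s = of_bool (val a s \<noteq> 0 \<and> val b s \<noteq> 0)"
  "val (Disj a b) s = of_bool (val a s \<noteq> 0 \<or> val b s \<noteq> 0)"
  "val (Neq a b) s = of_bool (val a s \<noteq> val b s)"
  by (auto simp: Neg_def Conj_def Disj_def Neq_def)

text \<open>Only negated operands are added, so the sum is at most \<open>2\<close> even when the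
  operands are large counts.\<close>

lemma fits_connectives [simp]:
  assumes "2 \<le> w"
  shows "fits w (Neg e) s \<longleftrightarrow> fits w e s"
    "fits w (Conj a b) s \<longleftrightarrow> fits w a s \<and> fits w b s"
    "fits w (Disj a b) s \<longleftrightarrow> fits w a s \<and> fits w b s"
    "fits w (Neq a b) s \<longleftrightarrow> fits w a s \<and> fits w b s"
  using assms by (auto simp: Neg_def Conj_def Disj_def Neq_def)

text \<open>
  With at most \<open>n\<close> iterations of every loop, \<open>c\<close> takes at most \<open>weight c * (n + 1) ^ depth c\<close> steps.
\<close>

primrec depth :: "com \<Rightarrow> nat" where
  "depth Skip = 0"
| "depth (Assign r e) = 0"
| "depth (Store a e\<^sub>1 e\<^sub>2) = 0"
| "depth (Seq c\<^sub>1 c\<^sub>2) = max (depth c\<^sub>1) (depth c\<^sub>2)"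
| "depth (If e c\<^sub>1 c\<^sub>2) = max (depth c\<^sub>1) (depth c\<^sub>2)"
| "depth (While e c) = Suc (depth c)"

primrec weight :: "com \<Rightarrow> nat" where
  "weight Skip = 1"
| "weight (Assign r e) = ecost e + 1"
| "weight (Store a e\<^sub>1 e\<^sub>2) = ecost e\<^sub>1 + ecost e\<^sub>2 + 1"
| "weight (Seq c\<^sub>1 c\<^sub>2) = weight c\<^sub>1 + weight c\<^sub>2"
| "weight (If e c\<^sub>1 c\<^sub>2) = ecost e + 1 + weight c\<^sub>1 + weight c\<^sub>2"
| "weight (While e c) = ecost e + 1 + weight c"

definition bound :: "nat \<Rightarrow> com \<Rightarrow> nat" where
  "bound n c = weight c * (n + 1) ^ depth c"

text \<open>The time bound depends on the program text alone; assertions speak only about states,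
  and costs are settled once per construct.\<close>

definition triple :: "nat \<Rightarrow> nat \<Rightarrow> (state \<Rightarrow> bool) \<Rightarrow> com \<Rightarrow> (state \<Rightarrow> bool) \<Rightarrow> bool" where
  "triple n w P c Q \<longleftrightarrow> (\<forall>s. P s \<longrightarrow> (\<exists>t s'. exec w c s t s' \<and> t \<le> bound n c \<and> Q s'))"

lemma triple_conseq:
  "triple n w P c Q \<Longrightarrow> (\<And>s. P' s \<Longrightarrow> P s) \<Longrightarrow> (\<And>s. Q s \<Longrightarrow> Q' s) \<Longrightarrow> triple n w P' c Q'"
  unfolding triple_def by meson

lemma triple_Skip: "(\<And>s. P s \<Longrightarrow> Q s) \<Longrightarrow> triple n w P Skip Q"
  unfolding triple_def bound_def using exec_Skip by fastforce

lemma triple_Assign: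
  assumes "\<And>s. P s \<Longrightarrow> fits w e s \<and> Q (s\<lparr>regs := (regs s)(r := val e s)\<rparr>)"
  shows "triple n w P (Assign r e) Q"
  unfolding triple_def
proof (intro allI impI)
  fix s assume "P s"
  with assms have "fits w e s" "Q (s\<lparr>regs := (regs s)(r := val e s)\<rparr>)" by auto
  with exec_Assign[OF aval_fits] show
    "\<exists>t s'. exec w (Assign r e) s t s' \<and> t \<le> bound n (Assign r e) \<and> Q s'"
    by (fastforce simp: bound_def)
qed

lemma triple_Store:
  assumes "\<And>s. P s \<Longrightarrow> fits w e\<^sub>1 s \<and> fits w e\<^sub>2 s \<and>
    Q (s\<lparr>arrs := (arrs s)(a := (arrs s a)(val e\<^sub>1 s := val e\<^sub>2 s))\<rparr>)"
  shows "triple n w P (Store a e\<^sub>1 e\<^sub>2) Q"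
  unfolding triple_def
proof (intro allI impI)
  fix s assume "P s"
  with assms have "fits w e\<^sub>1 s" "fits w e\<^sub>2 s"
    "Q (s\<lparr>arrs := (arrs s)(a := (arrs s a)(val e\<^sub>1 s := val e\<^sub>2 s))\<rparr>)" by auto
  with exec_Store[OF aval_fits aval_fits] show
    "\<exists>t s'. exec w (Store a e\<^sub>1 e\<^sub>2) s t s' \<and> t \<le> bound n (Store a e\<^sub>1 e\<^sub>2) \<and> Q s'"
    by (fastforce simp: bound_def)
qed

lemma bound_mono_depth: "depth c \<le> d \<Longrightarrow> bound n c \<le> weight c * (n + 1) ^ d"
  unfolding bound_def by (intro mult_le_mono2 power_increasing) auto

lemma triple_Seq:
  assumes "triple n w P c\<^sub>1 R" "triple n w R c\<^sub>2 Q"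
  shows "triple n w P (Seq c\<^sub>1 c\<^sub>2) Q"
  unfolding triple_def
proof (intro allI impI)
  fix s assume "P s"
  with assms(1) obtain t\<^sub>1 s\<^sub>1 where 1: "exec w c\<^sub>1 s t\<^sub>1 s\<^sub>1" "t\<^sub>1 \<le> bound n c\<^sub>1" "R s\<^sub>1"
    unfolding triple_def by blast
  with assms(2) obtain t\<^sub>2 s\<^sub>2 where 2: "exec w c\<^sub>2 s\<^sub>1 t\<^sub>2 s\<^sub>2" "t\<^sub>2 \<le> bound n c\<^sub>2" "Q s\<^sub>2"
    unfolding triple_def by blast
  let ?d = "depth (Seq c\<^sub>1 c\<^sub>2)"
  have "bound n c\<^sub>1 \<le> weight c\<^sub>1 * (n + 1) ^ ?d" "bound n c\<^sub>2 \<le> weight c\<^sub>2 * (n + 1) ^ ?d"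
    by (rule bound_mono_depth, simp)+
  with 1(2) 2(2) have "t\<^sub>1 + t\<^sub>2 \<le> bound n (Seq c\<^sub>1 c\<^sub>2)"
    unfolding bound_def[of n "Seq c\<^sub>1 c\<^sub>2"] weight.simps distrib_right by linarith
  with exec_Seq[OF 1(1) 2(1)] 2(3)
  show "\<exists>t s'. exec w (Seq c\<^sub>1 c\<^sub>2) s t s' \<and> t \<le> bound n (Seq c\<^sub>1 c\<^sub>2) \<and> Q s'" by blast
qed

lemma triple_If:
  assumes "\<And>s. P s \<Longrightarrow> fits w e s"
    and "triple n w (\<lambda>s. P s \<and> val e s \<noteq> 0) c\<^sub>1 Q" "triple n w (\<lambda>s. P s \<and> val e s = 0) c\<^sub>2 Q"
  shows "triple n w P (If e c\<^sub>1 c\<^sub>2) Q"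
  unfolding triple_def
proof (intro allI impI)
  fix s assume "P s"
  then have e: "aval w e s = Some (val e s)" using assms(1) by (simp add: aval_fits)
  let ?c = "If e c\<^sub>1 c\<^sub>2"
  have "1 \<le> (n + 1) ^ depth ?c" by simp
  then have le: "ecost e + 1 \<le> (ecost e + 1) * (n + 1) ^ depth ?c"
    by (metis mult.right_neutral mult_le_mono2)
  have le1: "ecost e + 1 + bound n c\<^sub>1 \<le> bound n ?c" and le2: "ecost e + 1 + bound n c\<^sub>2 \<le> bound n ?c"
    using le bound_mono_depth[of c\<^sub>1 "depth ?c" n] bound_mono_depth[of c\<^sub>2 "depth ?c" n]
    unfolding bound_def[of n ?c] weight.simps distrib_right by simp_all
  show "\<exists>t s'. exec w ?c s t s' \<and> t \<le> bound n ?c \<and> Q s'"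
  proof (cases "val e s = 0")
    case True
    with assms(3) \<open>P s\<close> obtain t s' where "exec w c\<^sub>2 s t s'" "t \<le> bound n c\<^sub>2" "Q s'"
      unfolding triple_def by blast
    with exec_If_false[OF e[unfolded True]] le2 show ?thesis
      by (meson add_left_mono order_trans)
  next
    case False
    with assms(2) \<open>P s\<close> obtain t s' where "exec w c\<^sub>1 s t s'" "t \<le> bound n c\<^sub>1" "Q s'"
      unfolding triple_def by blast
    with exec_If_true[OF e False] le1 show ?thesis
      by (meson add_left_mono order_trans)
  qed
qed

text \<open>Register \<open>0\<close> holds \<open>n\<close> during all loops; the answer overwrites
  it only at the very end.\<close>

definition For :: "nat \<Rightarrow> com \<Rightarrow> com" where
  "For r c = Seq (Assign r (Const 0))
     (While (Lt (Reg r) (Reg 0)) (Seq c (Assign r (Add (Reg r) (Const 1)))))"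

text \<open>The invariant is indexed by the number of completed rounds and must ignore the counter
  register, so that initialising and incrementing the counter preserve it.\<close>

lemma triple_For:
  assumes r: "r \<noteq> 0" and nw: "1 \<le> n" "n \<le> w"
    and indep: "\<And>i s x. Inv i (s\<lparr>regs := (regs s)(r := x)\<rparr>) = Inv i s"
    and reg0: "\<And>i s. Inv i s \<Longrightarrow> regs s 0 = n"
    and init: "\<And>s. P s \<Longrightarrow> Inv 0 s"
    and step: "\<And>i. i < n \<Longrightarrow> triple n w (\<lambda>s. Inv i s \<and> regs s r = i) c (\<lambda>s. Inv (Suc i) s \<and> regs s r = i)"
    and fin: "\<And>s. Inv n s \<Longrightarrow> Q s"
  shows "triple n w P (For r c) Q"
  unfolding triple_def
proof (intro allI impI)
  fix s assume "P s"
  let ?g = "Lt (Reg r) (Reg 0)" and ?b = "Seq c (Assign r (Add (Reg r) (Const 1)))"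
  \<comment> \<open>One test of the guard costs \<open>4\<close>; the final failing test accounts
    for the other \<open>4\<close> below.\<close>
  let ?B = "bound n ?b + 4"
  have "\<exists>t s'. exec w (While ?g ?b) s t s' \<and> t \<le> j * ?B + 4 \<and> Inv n s'"
    if "Inv i s" "regs s r = i" "j = n - i" "i \<le> n" for i j s
    using that
  proof (induction j arbitrary: i s)
    case 0
    then have "aval w ?g s = Some 0"
      using nw reg0[OF 0(1)] by (subst aval_fits) auto
    from exec_While_false[OF this] 0 show ?case by fastforce
  next
    case (Suc j)
    then have i: "i < n" by simp
    have g: "aval w ?g s = Some 1"
      using nw reg0[OF Suc.prems(1)] Suc.prems i by (subst aval_fits) auto
    have "triple n w (\<lambda>s. Inv i s \<and> regs s r = i) ?b (\<lambda>s. Inv (Suc i) s \<and> regs s r = Suc i)"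
      using nw i by (intro triple_Seq[OF step[OF i]] triple_Assign) (auto simp: indep)
    then obtain t s' where s': "exec w ?b s t s'" "t \<le> bound n ?b" "Inv (Suc i) s'" "regs s' r = Suc i"
      using Suc.prems unfolding triple_def by blast
    have "j = n - Suc i" "Suc i \<le> n" using Suc.prems i by auto
    from Suc.IH[OF s'(3,4) this] obtain t' s'' where s'': "exec w (While ?g ?b) s' t' s''" "t' \<le> j * ?B + 4" "Inv n s''"
      by blast
    from exec_While_true[OF g _ s'(1) s''(1)] s' s'' show ?case
      by (intro exI[of _ "ecost ?g + 1 + t + t'"] exI[of _ s'']) auto
  qed
  from this[of 0 "s\<lparr>regs := (regs s)(r := 0)\<rparr>" n] obtain t s'
    where 1: "exec w (While ?g ?b) (s\<lparr>regs := (regs s)(r := 0)\<rparr>) t s'" "t \<le> n * ?B + 4" "Inv n s'"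
    using init[OF \<open>P s\<close>] indep by auto
  have "exec w (Assign r (Const 0)) s 2 (s\<lparr>regs := (regs s)(r := 0)\<rparr>)"
    using exec_Assign[of w "Const 0" s 0 r] by (simp add: word_def numeral_2_eq_2)
  from exec_Seq[OF this 1(1)] have "exec w (For r c) s (2 + t) s'" by (simp add: For_def)
  moreover have "2 + t \<le> bound n (For r c)"
  proof -
    let ?p = "(n + 1) ^ depth c"
    have b: "bound n ?b = (weight c + 4) * ?p" by (simp add: bound_def algebra_simps)
    \<comment> \<open>The \<open>10\<close> consists of \<open>2\<close> for the initialisation,
      \<open>4\<close> for the guard and \<open>4\<close> for the increment.\<close>
    have F: "bound n (For r c) = (weight c + 10) * ((n + 1) * ?p)"
      by (simp add: bound_def For_def algebra_simps)
    have p: "1 \<le> ?p" by simp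
    have "2 + (n * ((weight c + 4) * ?p + 4) + 4) \<le> (weight c + 10) * ((n + 1) * ?p)"
    proof -
      have "n * 4 + 6 \<le> (4 * n + 6) * ?p" using p by (metis mult.commute mult.right_neutral mult_le_mono2)
      then show ?thesis by (simp add: algebra_simps)
    qed
    with 1(2) show ?thesis unfolding b F by linarith
  qed
  ultimately show "\<exists>t s'. exec w (For r c) s t s' \<and> t \<le> bound n (For r c) \<and> Q s'"
    using fin[OF 1(3)] by blast
qed

text \<open>Every innermost scan is such a count, and an existential test is a count that is not
  zero. The frame \<open>F\<close> carries along whatever else is known.\<close>

lemma triple_For_count:
  assumes "r \<noteq> 0" "a \<noteq> 0" "r \<noteq> a" "1 \<le> n" "n \<le> w"
    and indep: "\<And>s x y. F (s\<lparr>regs := (regs s)(r := x)\<rparr>) = F s" "\<And>s x y. F (s\<lparr>regs := (regs s)(a := x)\<rparr>) = F s"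
    and reg0: "\<And>s. F s \<Longrightarrow> regs s 0 = n"
    and e: "\<And>s. F s \<Longrightarrow> regs s r < n \<Longrightarrow> fits w e s \<and> val e s = of_bool (p (regs s r))"
  shows "triple n w F (Seq (Assign a (Const 0)) (For r (Assign a (Add (Reg a) e))))
    (\<lambda>s. F s \<and> regs s a = card {i. i < n \<and> p i})"
proof (rule triple_Seq)
  show "triple n w F (Assign a (Const 0)) (\<lambda>s. F s \<and> regs s a = 0)"
    using assms by (intro triple_Assign) auto
  have card_Suc: "card {j. j < Suc i \<and> p j} = card {j. j < i \<and> p j} + of_bool (p i)" for i
  proof -
    have "{j. j < Suc i \<and> p j} = (if p i then insert i {j. j < i \<and> p j} else {j. j < i \<and> p j})"
      by (auto simp: less_Suc_eq)
    then show ?thesis by simp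
  qed
  show "triple n w (\<lambda>s. F s \<and> regs s a = 0) (For r (Assign a (Add (Reg a) e)))
    (\<lambda>s. F s \<and> regs s a = card {i. i < n \<and> p i})"
  proof (rule triple_For[where Inv = "\<lambda>i s. F s \<and> regs s a = card {j. j < i \<and> p j}"])
    fix i assume i: "i < n"
    have "card {j. j < i \<and> p j} \<le> i"
      by (metis (no_types, lifting) card_lessThan card_mono finite_lessThan lessThan_iff mem_Collect_eq subsetI)
    with i \<open>n \<le> w\<close> have le: "card {j. j < i \<and> p j} \<le> w" "card {j. j < i \<and> p j} + of_bool (p i) \<le> w"
      by (auto split: if_splits)
    show "triple n w (\<lambda>s. (F s \<and> regs s a = card {j. j < i \<and> p j}) \<and> regs s r = i)
      (Assign a (Add (Reg a) e)) (\<lambda>s. (F s \<and> regs s a = card {j. j < Suc i \<and> p j}) \<and> regs s r = i)"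
    proof (rule triple_Assign)
      fix s assume s: "(F s \<and> regs s a = card {j. j < i \<and> p j}) \<and> regs s r = i"
      with e[of s] i le show "fits w (Add (Reg a) e) s \<and> (F (s\<lparr>regs := (regs s)(a := val (Add (Reg a) e) s)\<rparr>) \<and>
          regs (s\<lparr>regs := (regs s)(a := val (Add (Reg a) e) s)\<rparr>) a = card {j. j < Suc i \<and> p j}) \<and>
          regs (s\<lparr>regs := (regs s)(a := val (Add (Reg a) e) s)\<rparr>) r = i"
        using \<open>r \<noteq> a\<close> by (simp add: indep card_Suc)
    qed
  qed (use assms in auto)
qed

section \<open>The cubic algorithm\<close>

text \<open>
  Registers \<open>1\<close> to \<open>3\<close> are loop counters, \<open>4\<close> and \<open>5\<close> hold counts, \<open>6\<close> is a flag and \<open>7\<close> holds the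
  vertex \<open>z\<close>. Array \<open>2\<close> contains the degrees, and array \<open>3\<close> the indicator function of the clique.
\<close>

definition Edge :: "nat \<Rightarrow> nat \<Rightarrow> exp" where
  "Edge u v = Load 0 (Add (Mul (Reg u) (Reg 0)) (Reg v))"

definition Key :: "nat \<Rightarrow> exp" where
  "Key u = Add (Mul (Load 2 (Reg u)) (Reg 0)) (Sub (Reg 0) (Reg u))"

definition Top :: "nat \<Rightarrow> exp" where
  "Top u = Load 3 (Reg u)"

definition Count :: "nat \<Rightarrow> nat \<Rightarrow> exp \<Rightarrow> com" where
  "Count r a e = Seq (Assign a (Const 0)) (For r (Assign a (Add (Reg a) e)))"

definition degree_com :: com where
  "degree_com = For 1 (Seq (Count 2 4 (Edge 1 2)) (Store 2 (Reg 1) (Reg 4)))"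

definition top_com :: com where
  "top_com = For 1 (Seq (Count 2 4 (Lt (Key 1) (Key 2)))
     (Store 3 (Reg 1) (Lt (Reg 4) (Load 2 (Reg 1)))))"

definition check_com :: com where
  "check_com = Seq (Assign 6 (Const 0)) (For 1 (For 2 (Seq
     (Count 3 4 (Conj (Neg (Top 3)) (Conj (Edge 1 3) (Neg (Edge 2 3)))))
     (If (Disj (Conj (Conj (Top 1) (Top 2)) (Conj (Neq (Reg 1) (Reg 2)) (Neg (Conj (Edge 1 2) (Reg 4)))))
             (Conj (Neg (Disj (Top 1) (Top 2))) (Edge 1 2)))
       (Assign 6 (Const 1)) Skip))))"

text \<open>For a candidate \<open>z\<close> in register \<open>1\<close> and \<open>w\<close> in
  register \<open>2\<close>, a bad pair is one where both counts are non-zero. There is no early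
  exit: the last successful candidate remains in register \<open>7\<close>.\<close>

definition find_com :: com where
  "find_com = For 1 (Seq
     (Seq (Assign 6 (Const 0)) (For 2 (Seq
       (Seq (Count 3 4 (Conj (Top 3) (Conj (Edge 1 3) (Edge 2 3))))
            (Count 3 5 (Conj (Top 3) (Neg (Disj (Edge 1 3) (Edge 2 3))))))
       (If (Conj (Conj (Neg (Top 2)) (Neq (Reg 2) (Reg 1))) (Conj (Reg 4) (Reg 5)))
         (Assign 6 (Const 1)) Skip))))
     (If (Neg (Disj (Top 1) (Reg 6))) (Assign 7 (Reg 1)) Skip))"

text \<open>The value is \<open>4\<close> or \<open>3\<close> on the clique and \<open>2\<close> or
  \<open>1\<close> on other vertices, the smaller one when the subtracted truth value is
  \<open>1\<close>. For \<open>z\<close> both summands vanish.\<close>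

definition output_com :: com where
  "output_com = For 1 (Seq (Count 2 4 (Conj (Top 2) (Conj (Edge 7 2) (Edge 1 2))))
     (Store 1 (Reg 1)
       (Add (Mul (Top 1) (Sub (Const 4) (Edge 7 1)))
            (Mul (Conj (Neg (Top 1)) (Neq (Reg 1) (Reg 7))) (Sub (Const 2) (Neg (Neg (Reg 4))))))))"

definition decompose_com :: com where
  "decompose_com = Seq degree_com (Seq top_com (Seq check_com
     (If (Reg 6) (Assign 0 (Const 0)) (Seq find_com (Seq output_com (Assign 0 (Const 1)))))))"

lemma depth_decompose_com: "depth decompose_com = 3"
  by (simp add: decompose_com_def degree_com_def top_com_def check_com_def find_com_def
      output_com_def Count_def For_def)

lemma card_less_eq_0_iff [simp]: "card {i. i < (n::nat) \<and> p i} = 0 \<longleftrightarrow> (\<forall>i<n. \<not> p i)"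
proof -
  have "finite {i. i < n \<and> p i}" by simp
  then show ?thesis by (auto simp: card_eq_0_iff)
qed

text \<open>The word limit must hold matrix indices and keys, which are at most
  \<open>n * n + n\<close>, and constants up to \<open>4\<close>.\<close>

locale ram_graph =
  fixes n w :: nat and E :: "nat \<Rightarrow> nat \<Rightarrow> bool"
  assumes n: "1 \<le> n" and w: "w = (n + 2) ^ 2"
begin

definition matrix_stored :: "state \<Rightarrow> bool" where
  "matrix_stored s \<longleftrightarrow> regs s 0 = n \<and> (\<forall>u<n. \<forall>v<n. arrs s 0 (u * n + v) = of_bool (E u v))"

definition degrees_stored :: "nat \<Rightarrow> state \<Rightarrow> bool" where
  "degrees_stored i s \<longleftrightarrow> (\<forall>u<i. arrs s 2 u = degree n E u)"

definition top_stored :: "nat \<Rightarrow> state \<Rightarrow> bool" where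
  "top_stored i s \<longleftrightarrow> (\<forall>u<i. arrs s 3 u = of_bool (u \<in> top_set n E))"

lemma stored_frame [simp]:
  "r \<noteq> 0 \<Longrightarrow> matrix_stored (s\<lparr>regs := (regs s)(r := x)\<rparr>) = matrix_stored s"
  "a \<noteq> 0 \<Longrightarrow> matrix_stored (s\<lparr>arrs := (arrs s)(a := f)\<rparr>) = matrix_stored s"
  "degrees_stored i (s\<lparr>regs := g\<rparr>) = degrees_stored i s"
  "a \<noteq> 2 \<Longrightarrow> degrees_stored i (s\<lparr>arrs := (arrs s)(a := f)\<rparr>) = degrees_stored i s"
  "top_stored i (s\<lparr>regs := g\<rparr>) = top_stored i s"
  "a \<noteq> 3 \<Longrightarrow> top_stored i (s\<lparr>arrs := (arrs s)(a := f)\<rparr>) = top_stored i s"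
  by (simp_all add: matrix_stored_def degrees_stored_def top_stored_def)

lemma matrix_stored_reg0 [simp]: "matrix_stored s \<Longrightarrow> regs s 0 = n"
  by (simp add: matrix_stored_def)

lemma word_bounds [simp]: "n \<le> w" "4 \<le> w" "3 \<le> w" "2 \<le> w" "1 \<le> w" "Suc 0 \<le> w"
proof -
  have "w = n * n + 4 * n + 4" by (simp add: w power2_eq_square algebra_simps)
  then show "n \<le> w" "4 \<le> w" "3 \<le> w" "2 \<le> w" "1 \<le> w" "Suc 0 \<le> w" by simp_all
qed

lemma less_n_le_w [simp]: "u < n \<Longrightarrow> u \<le> w"
  using word_bounds(1) by linarith

text \<open>Non-strict bounds let the estimate also cover keys, where \<open>n - u\<close> can be
  \<open>n\<close>.\<close>

lemma index_le_w:
  assumes "u \<le> n" "v \<le> n"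
  shows "u * n + v \<le> w"
proof -
  have "u * n \<le> n * n" using assms by simp
  moreover have "w = n * n + 4 * n + 4" by (simp add: w power2_eq_square algebra_simps)
  ultimately show ?thesis using assms by linarith
qed

lemma degree_le: "degree n E u \<le> n"
  unfolding degree_def by (rule order_trans[OF card_mono[of "{..<n}"]]) auto

lemma of_bool_le_w [simp]: "of_bool b \<le> w"
  using order_trans[OF of_bool_less_eq_one word_bounds(5)] .

lemma Edge_correct [simp]:
  assumes "matrix_stored s" "regs s u < n" "regs s v < n"
  shows "fits w (Edge u v) s" "val (Edge u v) s = of_bool (E (regs s u) (regs s v))"
proof -
  have "regs s u * n + regs s v \<le> w"
    using assms by (intro index_le_w) auto
  moreover from this have "regs s u * n \<le> w" by linarith
  ultimately show "fits w (Edge u v) s" "val (Edge u v) s = of_bool (E (regs s u) (regs s v))"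
    using assms by (simp_all add: Edge_def matrix_stored_def del: matrix_stored_reg0)
qed

lemma Key_correct [simp]:
  assumes "matrix_stored s" "degrees_stored n s" "regs s u < n"
  shows "fits w (Key u) s" "val (Key u) s = key n E (regs s u)"
proof -
  have "degree n E (regs s u) * n + (n - regs s u) \<le> w"
    by (intro index_le_w degree_le) simp
  moreover from this have "degree n E (regs s u) * n \<le> w" by linarith
  moreover have "degree n E (regs s u) \<le> w" using degree_le word_bounds(1) by (rule order_trans)
  ultimately show "fits w (Key u) s" "val (Key u) s = key n E (regs s u)"
    using assms by (simp_all add: Key_def key_def degrees_stored_def)
qed

lemma Top_correct [simp]:
  assumes "top_stored n s" "regs s u < n"
  shows "fits w (Top u) s" "val (Top u) s = of_bool (regs s u \<in> top_set n E)"
  using assms by (auto simp: Top_def top_stored_def)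

lemmas triple_For' = triple_For[OF _ n word_bounds(1)]
  and triple_Count = triple_For_count[OF _ _ _ n word_bounds(1), folded Count_def]

section \<open>Correctness of the passes of the program\<close>

lemma triple_degree_com:
  "triple n w matrix_stored degree_com (\<lambda>s. matrix_stored s \<and> degrees_stored n s)"
  unfolding degree_com_def
proof (rule triple_For'[where Inv = "\<lambda>i s. matrix_stored s \<and> degrees_stored i s"])
  fix i assume i: "i < n"
  show "triple n w (\<lambda>s. (matrix_stored s \<and> degrees_stored i s) \<and> regs s 1 = i)
     (Seq (Count 2 4 (Edge 1 2)) (Store 2 (Reg 1) (Reg 4)))
     (\<lambda>s. (matrix_stored s \<and> degrees_stored (Suc i) s) \<and> regs s 1 = i)"
  proof (rule triple_Seq)
    show "triple n w (\<lambda>s. (matrix_stored s \<and> degrees_stored i s) \<and> regs s 1 = i) (Count 2 4 (Edge 1 2))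
      (\<lambda>s. ((matrix_stored s \<and> degrees_stored i s) \<and> regs s 1 = i) \<and> regs s 4 = card {v. v < n \<and> E i v})"
      using i by (intro triple_Count) auto
    show "triple n w (\<lambda>s. ((matrix_stored s \<and> degrees_stored i s) \<and> regs s 1 = i) \<and> regs s 4 = card {v. v < n \<and> E i v})
      (Store 2 (Reg 1) (Reg 4)) (\<lambda>s. (matrix_stored s \<and> degrees_stored (Suc i) s) \<and> regs s 1 = i)"
      using i order_trans[OF degree_le[unfolded degree_def] word_bounds(1)]
      by (intro triple_Store) (auto simp: degrees_stored_def degree_def less_Suc_eq)
  qed
qed (auto simp: degrees_stored_def)

lemma triple_top_com:
  "triple n w (\<lambda>s. matrix_stored s \<and> degrees_stored n s) top_com (\<lambda>s. matrix_stored s \<and> top_stored n s)"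
  unfolding top_com_def
proof (rule triple_For'[where Inv = "\<lambda>i s. matrix_stored s \<and> degrees_stored n s \<and> top_stored i s"])
  fix i assume i: "i < n"
  let ?F = "\<lambda>s. (matrix_stored s \<and> degrees_stored n s \<and> top_stored i s) \<and> regs s 1 = i"
  let ?c = "card {v. v < n \<and> key n E i < key n E v}"
  show "triple n w ?F
     (Seq (Count 2 4 (Lt (Key 1) (Key 2))) (Store 3 (Reg 1) (Lt (Reg 4) (Load 2 (Reg 1)))))
     (\<lambda>s. (matrix_stored s \<and> degrees_stored n s \<and> top_stored (Suc i) s) \<and> regs s 1 = i)"
  proof (rule triple_Seq)
    show "triple n w ?F (Count 2 4 (Lt (Key 1) (Key 2))) (\<lambda>s. ?F s \<and> regs s 4 = ?c)"
      using i by (intro triple_Count) auto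
    have "?c \<le> n"
      by (rule order_trans[OF card_mono[of "{..<n}"]]) auto
    then have "?c \<le> w" using word_bounds(1) by linarith
    moreover have "degree n E i \<le> w" using degree_le word_bounds(1) by (rule order_trans)
    ultimately show "triple n w (\<lambda>s. ?F s \<and> regs s 4 = ?c) (Store 3 (Reg 1) (Lt (Reg 4) (Load 2 (Reg 1))))
      (\<lambda>s. (matrix_stored s \<and> degrees_stored n s \<and> top_stored (Suc i) s) \<and> regs s 1 = i)"
      using i by (intro triple_Store) (auto simp: degrees_stored_def top_stored_def top_set_def less_Suc_eq)
  qed
qed (auto simp: top_stored_def)

abbreviation "T \<equiv> top_set n E"

abbreviation graph_stored :: "state \<Rightarrow> bool" where
  "graph_stored s \<equiv> matrix_stored s \<and> top_stored n s"

text \<open>The negated pair condition of \<open>labeled_clique_sperner_iff\<close> for the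
  candidate \<open>T\<close>.\<close>

definition violation :: "nat \<Rightarrow> nat \<Rightarrow> bool" where
  "violation u v \<longleftrightarrow>
     u \<in> T \<and> v \<in> T \<and> u \<noteq> v \<and> \<not> (E u v \<and> (\<exists>x<n. x \<notin> T \<and> E u x \<and> \<not> E v x)) \<or>
     u \<notin> T \<and> v \<notin> T \<and> E u v"

lemma card_le_w [simp]: "card {i. i < n \<and> p i} \<le> w"
proof -
  have "card {i. i < n \<and> p i} \<le> card {..<n}" by (intro card_mono) auto
  then show ?thesis using word_bounds(1) unfolding card_lessThan by linarith
qed

lemma triple_check_com:
  "triple n w graph_stored check_com
     (\<lambda>s. graph_stored s \<and> regs s 6 = of_bool (\<exists>u<n. \<exists>v<n. violation u v))"
  unfolding check_com_def
proof (rule triple_Seq)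
  show "triple n w graph_stored (Assign 6 (Const 0)) (\<lambda>s. graph_stored s \<and> regs s 6 = 0)"
    by (intro triple_Assign) auto
  let ?I = "\<lambda>i s. graph_stored s \<and> regs s 6 = of_bool (\<exists>u<i. \<exists>v<n. violation u v)"
  show "triple n w (\<lambda>s. graph_stored s \<and> regs s 6 = 0) (For 1 (For 2 (Seq
     (Count 3 4 (Conj (Neg (Top 3)) (Conj (Edge 1 3) (Neg (Edge 2 3)))))
     (If (Disj (Conj (Conj (Top 1) (Top 2)) (Conj (Neq (Reg 1) (Reg 2)) (Neg (Conj (Edge 1 2) (Reg 4)))))
             (Conj (Neg (Disj (Top 1) (Top 2))) (Edge 1 2)))
       (Assign 6 (Const 1)) Skip)))) (?I n)"
  proof (rule triple_For'[where Inv = ?I])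
    fix i assume i: "i < n"
    let ?J = "\<lambda>j s. graph_stored s \<and> regs s 1 = i \<and>
      regs s 6 = of_bool ((\<exists>u<i. \<exists>v<n. violation u v) \<or> (\<exists>v<j. violation i v))"
    show "triple n w (\<lambda>s. ?I i s \<and> regs s 1 = i) (For 2 (Seq
     (Count 3 4 (Conj (Neg (Top 3)) (Conj (Edge 1 3) (Neg (Edge 2 3)))))
     (If (Disj (Conj (Conj (Top 1) (Top 2)) (Conj (Neq (Reg 1) (Reg 2)) (Neg (Conj (Edge 1 2) (Reg 4)))))
             (Conj (Neg (Disj (Top 1) (Top 2))) (Edge 1 2)))
       (Assign 6 (Const 1)) Skip))) (\<lambda>s. ?I (Suc i) s \<and> regs s 1 = i)"
    proof (rule triple_For'[where Inv = ?J])
      fix j assume j: "j < n"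
      let ?F = "\<lambda>s. ?J j s \<and> regs s 2 = j"
      let ?G = "\<lambda>s. ?F s \<and> regs s 4 = card {x. x < n \<and> x \<notin> T \<and> E i x \<and> \<not> E j x}"
      let ?e = "Disj (Conj (Conj (Top 1) (Top 2)) (Conj (Neq (Reg 1) (Reg 2)) (Neg (Conj (Edge 1 2) (Reg 4)))))
             (Conj (Neg (Disj (Top 1) (Top 2))) (Edge 1 2))"
      have e: "fits w ?e s" "val ?e s = of_bool (violation i j)" if "?G s" for s
        using that i j by (auto simp: violation_def)
      show "triple n w ?F (Seq (Count 3 4 (Conj (Neg (Top 3)) (Conj (Edge 1 3) (Neg (Edge 2 3)))))
         (If ?e (Assign 6 (Const 1)) Skip)) (\<lambda>s. ?J (Suc j) s \<and> regs s 2 = j)"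
      proof (rule triple_Seq)
        show "triple n w ?F (Count 3 4 (Conj (Neg (Top 3)) (Conj (Edge 1 3) (Neg (Edge 2 3))))) ?G"
          using i j by (intro triple_Count) auto
        show "triple n w ?G (If ?e (Assign 6 (Const 1)) Skip) (\<lambda>s. ?J (Suc j) s \<and> regs s 2 = j)"
        proof (rule triple_If)
          show "fits w ?e s" if "?G s" for s using e(1)[OF that] .
          show "triple n w (\<lambda>s. ?G s \<and> val ?e s \<noteq> 0) (Assign 6 (Const 1)) (\<lambda>s. ?J (Suc j) s \<and> regs s 2 = j)"
          proof (rule triple_Assign)
            fix s assume s: "?G s \<and> val ?e s \<noteq> 0"
            from conjunct2[OF s] have "violation i j" unfolding e(2)[OF conjunct1[OF s]] by simp
            with conjunct1[OF s] show "fits w (Const 1) s \<and> ?J (Suc j) (s\<lparr>regs := (regs s)(6 := val (Const 1) s)\<rparr>) \<and>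
              regs (s\<lparr>regs := (regs s)(6 := val (Const 1) s)\<rparr>) 2 = j"
              by auto
          qed
          show "triple n w (\<lambda>s. ?G s \<and> val ?e s = 0) Skip (\<lambda>s. ?J (Suc j) s \<and> regs s 2 = j)"
          proof (rule triple_Skip)
            fix s assume s: "?G s \<and> val ?e s = 0"
            from conjunct2[OF s] have "\<not> violation i j" unfolding e(2)[OF conjunct1[OF s]] by simp
            with conjunct1[OF s] show "?J (Suc j) s \<and> regs s 2 = j"
              by (simp add: Ex_less_Suc)
          qed
        qed
      qed
    qed (auto simp: Ex_less_Suc)
  qed auto
qed

text \<open>The negation of the dichotomy in \<open>ex_gluing_vertex\<close>.\<close>

definition conflict :: "nat \<Rightarrow> nat \<Rightarrow> bool" where
  "conflict z x \<longleftrightarrow> x \<notin> T \<and> x \<noteq> z \<and> (\<exists>u<n. u \<in> T \<and> E z u \<and> E x u) \<and>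
     (\<exists>u<n. u \<in> T \<and> \<not> (E z u \<or> E x u))"

definition gluing_vertex :: "nat \<Rightarrow> bool" where
  "gluing_vertex z \<longleftrightarrow> z \<notin> T \<and> (\<forall>x<n. \<not> conflict z x)"

lemma triple_find_com:
  assumes "\<exists>z<n. gluing_vertex z"
  shows "triple n w graph_stored find_com
     (\<lambda>s. graph_stored s \<and> regs s 7 < n \<and> gluing_vertex (regs s 7))"
  unfolding find_com_def
proof (rule triple_For')
  \<comment> \<open>Register \<open>7\<close> is meaningful only after a gluing vertex has been
    passed, hence the implication.\<close>
  let ?I = "\<lambda>i s. graph_stored s \<and> ((\<exists>z<i. gluing_vertex z) \<longrightarrow> regs s 7 < n \<and> gluing_vertex (regs s 7))"
  show "?I i (s\<lparr>regs := (regs s)(1 := x)\<rparr>) = ?I i s" for i s x by simp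
  show "regs s 0 = n" if "?I i s" for i s using that by simp
  show "?I 0 s" if "graph_stored s" for s using that by simp
  show "graph_stored s \<and> regs s 7 < n \<and> gluing_vertex (regs s 7)" if "?I n s" for s
    using that assms by blast
  fix i assume i: "i < n"
  let ?H = "\<lambda>s. ?I i s \<and> regs s 1 = i"
  let ?J = "\<lambda>j s. ?H s \<and> regs s 6 = of_bool (\<exists>x<j. conflict i x)"
  let ?e = "Conj (Conj (Neg (Top 2)) (Neq (Reg 2) (Reg 1))) (Conj (Reg 4) (Reg 5))"
  show "triple n w ?H (Seq (Seq (Assign 6 (Const 0)) (For 2 (Seq
       (Seq (Count 3 4 (Conj (Top 3) (Conj (Edge 1 3) (Edge 2 3))))
            (Count 3 5 (Conj (Top 3) (Neg (Disj (Edge 1 3) (Edge 2 3))))))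
       (If ?e (Assign 6 (Const 1)) Skip))))
     (If (Neg (Disj (Top 1) (Reg 6))) (Assign 7 (Reg 1)) Skip)) (\<lambda>s. ?I (Suc i) s \<and> regs s 1 = i)"
  proof (intro triple_Seq)
    show "triple n w ?H (Assign 6 (Const 0)) (?J 0)"
      by (intro triple_Assign) auto
    show "triple n w (?J 0) (For 2 (Seq
       (Seq (Count 3 4 (Conj (Top 3) (Conj (Edge 1 3) (Edge 2 3))))
            (Count 3 5 (Conj (Top 3) (Neg (Disj (Edge 1 3) (Edge 2 3))))))
       (If ?e (Assign 6 (Const 1)) Skip))) (?J n)"
    proof (rule triple_For'[where Inv = ?J])
      fix j assume j: "j < n"
      let ?F = "\<lambda>s. ?J j s \<and> regs s 2 = j"
      let ?G = "\<lambda>s. ?F s \<and> regs s 4 = card {u. u < n \<and> u \<in> T \<and> E i u \<and> E j u}"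
      let ?G' = "\<lambda>s. ?G s \<and> regs s 5 = card {u. u < n \<and> u \<in> T \<and> \<not> (E i u \<or> E j u)}"
      have e: "fits w ?e s" "val ?e s = of_bool (conflict i j)" if "?G' s" for s
        using that i j by (auto simp: conflict_def)
      show "triple n w ?F (Seq
         (Seq (Count 3 4 (Conj (Top 3) (Conj (Edge 1 3) (Edge 2 3))))
              (Count 3 5 (Conj (Top 3) (Neg (Disj (Edge 1 3) (Edge 2 3))))))
         (If ?e (Assign 6 (Const 1)) Skip)) (\<lambda>s. ?J (Suc j) s \<and> regs s 2 = j)"
      proof (intro triple_Seq)
        show "triple n w ?F (Count 3 4 (Conj (Top 3) (Conj (Edge 1 3) (Edge 2 3)))) ?G"
          using i j by (intro triple_Count) auto
        show "triple n w ?G (Count 3 5 (Conj (Top 3) (Neg (Disj (Edge 1 3) (Edge 2 3))))) ?G'"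
          using i j by (intro triple_Count) auto
        show "triple n w ?G' (If ?e (Assign 6 (Const 1)) Skip) (\<lambda>s. ?J (Suc j) s \<and> regs s 2 = j)"
        proof (rule triple_If)
          show "fits w ?e s" if "?G' s" for s using e(1)[OF that] .
          show "triple n w (\<lambda>s. ?G' s \<and> val ?e s \<noteq> 0) (Assign 6 (Const 1)) (\<lambda>s. ?J (Suc j) s \<and> regs s 2 = j)"
          proof (rule triple_Assign)
            fix s assume s: "?G' s \<and> val ?e s \<noteq> 0"
            from conjunct2[OF s] have "conflict i j" unfolding e(2)[OF conjunct1[OF s]] by simp
            with conjunct1[OF s] show "fits w (Const 1) s \<and> ?J (Suc j) (s\<lparr>regs := (regs s)(6 := val (Const 1) s)\<rparr>) \<and>
              regs (s\<lparr>regs := (regs s)(6 := val (Const 1) s)\<rparr>) 2 = j"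
              by auto
          qed
          show "triple n w (\<lambda>s. ?G' s \<and> val ?e s = 0) Skip (\<lambda>s. ?J (Suc j) s \<and> regs s 2 = j)"
          proof (rule triple_Skip)
            fix s assume s: "?G' s \<and> val ?e s = 0"
            from conjunct2[OF s] have "\<not> conflict i j" unfolding e(2)[OF conjunct1[OF s]] by simp
            with conjunct1[OF s] show "?J (Suc j) s \<and> regs s 2 = j"
              by (simp add: Ex_less_Suc)
          qed
        qed
      qed
    qed auto
    have e: "fits w (Neg (Disj (Top 1) (Reg 6))) s"
        "val (Neg (Disj (Top 1) (Reg 6))) s = of_bool (gluing_vertex i)" if "?J n s" for s
      using that i by (auto simp: gluing_vertex_def)
    show "triple n w (?J n) (If (Neg (Disj (Top 1) (Reg 6))) (Assign 7 (Reg 1)) Skip)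
      (\<lambda>s. ?I (Suc i) s \<and> regs s 1 = i)"
    proof (rule triple_If)
      show "fits w (Neg (Disj (Top 1) (Reg 6))) s" if "?J n s" for s using e(1)[OF that] .
      show "triple n w (\<lambda>s. ?J n s \<and> val (Neg (Disj (Top 1) (Reg 6))) s \<noteq> 0) (Assign 7 (Reg 1))
        (\<lambda>s. ?I (Suc i) s \<and> regs s 1 = i)"
      proof (rule triple_Assign)
        fix s assume s: "?J n s \<and> val (Neg (Disj (Top 1) (Reg 6))) s \<noteq> 0"
        from conjunct2[OF s] have "gluing_vertex i" unfolding e(2)[OF conjunct1[OF s]] by simp
        with conjunct1[OF s] i show "fits w (Reg 1) s \<and> ?I (Suc i) (s\<lparr>regs := (regs s)(7 := val (Reg 1) s)\<rparr>) \<and>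
              regs (s\<lparr>regs := (regs s)(7 := val (Reg 1) s)\<rparr>) 1 = i"
          by simp
      qed
      show "triple n w (\<lambda>s. ?J n s \<and> val (Neg (Disj (Top 1) (Reg 6))) s = 0) Skip
        (\<lambda>s. ?I (Suc i) s \<and> regs s 1 = i)"
      proof (rule triple_Skip)
        fix s assume s: "?J n s \<and> val (Neg (Disj (Top 1) (Reg 6))) s = 0"
        from conjunct2[OF s] have "\<not> gluing_vertex i" unfolding e(2)[OF conjunct1[OF s]] by simp
        with conjunct1[OF s] show "?I (Suc i) s \<and> regs s 1 = i" by (simp add: Ex_less_Suc)
      qed
    qed
  qed
qed simp

definition part :: "nat \<Rightarrow> nat \<Rightarrow> nat" where
  "part z x = (if x \<in> T then (if E z x then 3 else 4) else if x = z then 0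
     else if \<exists>u<n. u \<in> T \<and> E z u \<and> E x u then 1 else 2)"

lemma triple_output_com:
  "triple n w (\<lambda>s. graph_stored s \<and> regs s 7 < n \<and> gluing_vertex (regs s 7)) output_com
     (\<lambda>s. \<exists>z<n. gluing_vertex z \<and> (\<forall>x<n. arrs s 1 x = part z x))"
  unfolding output_com_def
proof (rule triple_For')
  let ?I = "\<lambda>i s. graph_stored s \<and> regs s 7 < n \<and> gluing_vertex (regs s 7) \<and>
    (\<forall>x<i. arrs s 1 x = part (regs s 7) x)"
  show "?I i (s\<lparr>regs := (regs s)(1 := x)\<rparr>) = ?I i s" for i s x by simp
  show "regs s 0 = n" if "?I i s" for i s using that by simp
  show "?I 0 s" if "graph_stored s \<and> regs s 7 < n \<and> gluing_vertex (regs s 7)" for s using that by simp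
  show "\<exists>z<n. gluing_vertex z \<and> (\<forall>x<n. arrs s 1 x = part z x)" if "?I n s" for s
    using that by blast
  fix i assume i: "i < n"
  let ?e = "Add (Mul (Top 1) (Sub (Const 4) (Edge 7 1)))
            (Mul (Conj (Neg (Top 1)) (Neq (Reg 1) (Reg 7))) (Sub (Const 2) (Neg (Neg (Reg 4)))))"
  let ?F = "\<lambda>s. ?I i s \<and> regs s 1 = i"
  let ?N = "\<lambda>s. \<exists>u<n. u \<in> T \<and> E (regs s 7) u \<and> E i u"
  let ?G = "\<lambda>s. ?F s \<and> regs s 4 \<le> w \<and> (regs s 4 \<noteq> 0 \<longleftrightarrow> ?N s)"
  show "triple n w ?F (Seq (Count 2 4 (Conj (Top 2) (Conj (Edge 7 2) (Edge 1 2)))) (Store 1 (Reg 1) ?e))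
     (\<lambda>s. ?I (Suc i) s \<and> regs s 1 = i)"
  proof (rule triple_Seq)
    \<comment> \<open>Counting needs a predicate independent of the state, so register
      \<open>7\<close> is frozen to a fixed \<open>z\<close> and released afterwards.\<close>
    have "triple n w (\<lambda>s. ?F s \<and> regs s 7 = z) (Count 2 4 (Conj (Top 2) (Conj (Edge 7 2) (Edge 1 2)))) ?G" for z
    proof (rule triple_conseq)
      let ?c = "card {u. u < n \<and> u \<in> T \<and> E z u \<and> E i u}"
      show "triple n w (\<lambda>s. ?F s \<and> regs s 7 = z) (Count 2 4 (Conj (Top 2) (Conj (Edge 7 2) (Edge 1 2))))
        (\<lambda>s. (?F s \<and> regs s 7 = z) \<and> regs s 4 = ?c)"
        using i by (intro triple_Count) auto
      show "?G s" if s: "(?F s \<and> regs s 7 = z) \<and> regs s 4 = ?c" for s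
      proof -
        from s have "regs s 4 = ?c" "regs s 7 = z" by blast+
        then have "regs s 4 \<le> w" "regs s 4 \<noteq> 0 \<longleftrightarrow> ?N s" by (simp_all only: card_le_w card_less_eq_0_iff) blast
        with s show ?thesis by blast
      qed
    qed
    then show "triple n w ?F (Count 2 4 (Conj (Top 2) (Conj (Edge 7 2) (Edge 1 2)))) ?G"
      unfolding triple_def by blast
    have e: "fits w ?e s" "val ?e s = part (regs s 7) i" if "?G s" for s
      using that i by (auto simp: part_def)
    show "triple n w ?G (Store 1 (Reg 1) ?e) (\<lambda>s. ?I (Suc i) s \<and> regs s 1 = i)"
    proof (rule triple_Store)
      fix s assume s: "?G s"
      note f = e(1)[OF s] and v = e(2)[OF s]
      show "fits w (Reg 1) s \<and> fits w ?e s \<and>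
        ?I (Suc i) (s\<lparr>arrs := (arrs s)(1 := (arrs s 1)(val (Reg 1) s := val ?e s))\<rparr>) \<and>
        regs (s\<lparr>arrs := (arrs s)(1 := (arrs s 1)(val (Reg 1) s := val ?e s))\<rparr>) 1 = i"
        unfolding v using s f i by (simp del: fits.simps add: less_Suc_eq) simp
    qed
  qed
qed simp

text \<open>The program is verified for an arbitrary relation \<open>E\<close>; the assumption is
  the place where graph theory enters.\<close>

lemma triple_decompose_com:
  assumes "(\<forall>u<n. \<forall>v<n. \<not> violation u v) \<Longrightarrow> \<exists>z<n. gluing_vertex z"
  shows "triple n w matrix_stored decompose_com
     (\<lambda>s. regs s 0 = 0 \<and> (\<exists>u<n. \<exists>v<n. violation u v) \<or>
          regs s 0 = 1 \<and> (\<forall>u<n. \<forall>v<n. \<not> violation u v) \<and>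
          (\<exists>z<n. gluing_vertex z \<and> (\<forall>x<n. arrs s 1 x = part z x)))" (is "triple n w _ _ ?Q")
  unfolding decompose_com_def
proof (intro triple_Seq[OF triple_degree_com] triple_Seq[OF triple_top_com] triple_Seq[OF triple_check_com])
  let ?V = "\<exists>u<n. \<exists>v<n. violation u v"
  show "triple n w (\<lambda>s. graph_stored s \<and> regs s 6 = of_bool ?V)
    (If (Reg 6) (Assign 0 (Const 0)) (Seq find_com (Seq output_com (Assign 0 (Const 1))))) ?Q"
  proof (cases ?V)
    case True
    show ?thesis
    proof (rule triple_If)
      show "triple n w (\<lambda>s. (graph_stored s \<and> regs s 6 = of_bool ?V) \<and> val (Reg 6) s \<noteq> 0) (Assign 0 (Const 0)) ?Q"
        using True by (intro triple_Assign) auto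
      show "triple n w (\<lambda>s. (graph_stored s \<and> regs s 6 = of_bool ?V) \<and> val (Reg 6) s = 0)
        (Seq find_com (Seq output_com (Assign 0 (Const 1)))) ?Q"
        using True by (auto simp: triple_def)
    qed auto
  next
    case False
    then have "\<exists>z<n. gluing_vertex z" using assms by blast
    have "triple n w graph_stored (Seq find_com (Seq output_com (Assign 0 (Const 1)))) ?Q"
    proof (intro triple_Seq[OF triple_find_com[OF \<open>\<exists>z<n. gluing_vertex z\<close>]] triple_Seq[OF triple_output_com] triple_Assign)
      fix s :: state assume "\<exists>z<n. gluing_vertex z \<and> (\<forall>x<n. arrs s 1 x = part z x)"
      then show "fits w (Const 1) s \<and> ?Q (s\<lparr>regs := (regs s)(0 := val (Const 1) s)\<rparr>)"
        using False by simp
    qed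
    then have *: "triple n w (\<lambda>s. (graph_stored s \<and> regs s 6 = of_bool ?V) \<and> val (Reg 6) s = 0)
        (Seq find_com (Seq output_com (Assign 0 (Const 1)))) ?Q"
      by (rule triple_conseq) auto
    show ?thesis
    proof (rule triple_If[OF _ _ *])
      show "triple n w (\<lambda>s. (graph_stored s \<and> regs s 6 = of_bool ?V) \<and> val (Reg 6) s \<noteq> 0) (Assign 0 (Const 0)) ?Q"
        using False by (auto simp: triple_def)
    qed auto
  qed
qed

lemma matrix_stored_input_state:
  assumes "E = dominates G"
  shows "matrix_stored (input_state n G)"
proof -
  have "u * n + v < n * n" if "u < n" "v < n" for u v
  proof -
    have "u * n + v < Suc u * n" using that by simp
    also have "\<dots> \<le> n * n" using that by (intro mult_le_mono1) simp
    finally show ?thesis .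
  qed
  then show ?thesis
    unfolding matrix_stored_def input_state_def by (simp add: assms)
qed

end

section \<open>From final states to graphs\<close>

lemma (in ram_graph) correct_output_if_decomposed:
  assumes G: "graph G" "verts G = {..<n}" "H_free G" and E: "E = dominates G"
    and L: "labeled_clique_sperner G T ({..<n} - T)"
    and z: "z < n" "gluing_vertex z" and out: "regs s 0 = 1" "\<forall>x<n. arrs s 1 x = part z x"
  shows "correct_output n G s"
proof -
  let ?P = "output_part n s"
  have "T \<subseteq> {..<n}" by (auto simp: top_set_def)
  have zT: "z \<notin> T" using z by (simp add: gluing_vertex_def)
  have P: "?P j = {x. x < n \<and> part z x = j}" for j
    using out by (auto simp: output_part_def)
  have P0: "?P 0 = {z}"
    unfolding P part_def using z zT by auto
  have P1: "?P 1 = {x. x < n \<and> x \<notin> T \<and> x \<noteq> z \<and> (\<exists>u<n. u \<in> T \<and> E z u \<and> E x u)}"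
    and P2: "?P 2 = {x. x < n \<and> x \<notin> T \<and> x \<noteq> z \<and> \<not> (\<exists>u<n. u \<in> T \<and> E z u \<and> E x u)}"
    and P3: "?P 3 = T \<inter> nbhd G z" and P4: "?P 4 = T - nbhd G z"
    unfolding P part_def nbhd_def using \<open>T \<subseteq> {..<n}\<close> E by (auto split: if_splits)
  have "sperner_decomposition G T ({..<n} - T) z (?P 1) (?P 2) (?P 3) (?P 4)"
  proof (rule sperner_decompositionI[OF G(1,3) L P3 P4])
    show "{..<n} - T = {z} \<union> ?P 1 \<union> ?P 2" "z \<notin> ?P 1" "z \<notin> ?P 2" "?P 1 \<inter> ?P 2 = {}"
      using z zT unfolding P1 P2 by auto
    show "x \<rightarrow>\<^bsub>G\<^esub> u" if x: "x \<in> ?P 1" and u: "u \<in> ?P 4" for x u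
    proof -
      \<comment> \<open>\<open>x\<close> shares a clique neighbour with \<open>z\<close>, so without
        conflict the two together cover \<open>T\<close>.\<close>
      have "\<not> conflict z x" using z x unfolding P1 gluing_vertex_def by blast
      with x have "u \<in> T \<Longrightarrow> E z u \<or> E x u" if "u < n" for u
        using that unfolding P1 conflict_def by blast
      then show ?thesis
        using u \<open>T \<subseteq> {..<n}\<close> E unfolding P4 nbhd_def by auto
    qed
    show "\<not> x \<rightarrow>\<^bsub>G\<^esub> u" if x: "x \<in> ?P 2" and u: "u \<in> ?P 3" for x u
    proof -
      have "\<not> (u < n \<and> u \<in> T \<and> E z u \<and> E x u)" using x unfolding P2 by blast
      moreover have "u < n" "u \<in> T" "E z u" using u \<open>T \<subseteq> {..<n}\<close> E unfolding P3 nbhd_def by auto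
      ultimately show ?thesis using E by blast
    qed
  qed
  then show ?thesis
    using L P0 out(1) unfolding correct_output_def by blast
qed

lemma decompose_com_correct:
  fixes G :: "(nat, 'b) pre_digraph"
  assumes "1 \<le> n" and G: "graph G" "verts G = {..<n}" "H_free G"
  shows "\<exists>t s. exec ((n + 2) ^ 2) decompose_com (input_state n G) t s \<and>
    t \<le> bound n decompose_com \<and> correct_output n G s"
proof -
  interpret ram_graph n "(n + 2) ^ 2" "dominates G"
    by unfold_locales (use assms(1) in simp_all)
  have T: "T \<subseteq> {..<n}" by (auto simp: top_set_def)
  have L: "labeled_clique_sperner G T ({..<n} - T) \<longleftrightarrow> (\<forall>u<n. \<forall>v<n. \<not> violation u v)"
    unfolding labeled_clique_sperner_iff[OF G(1,2) T] violation_def by blast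
  have gv: "\<exists>z<n. gluing_vertex z" if "\<forall>u<n. \<forall>v<n. \<not> violation u v"
  proof -
    have "{..<n} - T \<noteq> {}"
    \<comment> \<open>A lone vertex has degree \<open>0\<close>, so its rank \<open>0\<close> is not
      smaller and it falls outside \<open>T\<close>.\<close>
    proof (cases "n = 1")
      case True
      have "\<not> 0 \<rightarrow>\<^bsub>G\<^esub> 0"
        using not_dominates_self[OF G(1)] .
      with True have "{v. v < n \<and> 0 \<rightarrow>\<^bsub>G\<^esub> v} = {}" by auto
      then have "degree n (dominates G) 0 = 0" unfolding degree_def by (metis card.empty)
      then have "0 \<notin> T" by (simp add: top_set_def)
      with True show ?thesis by auto
    next
      case False
      with assms(1) G have "2 \<le> card (verts G)" by simp
      then show ?thesis using labeled_clique_sperner_indep_nonempty L that by blast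
    qed
    with ex_gluing_vertex[OF G(1,3) L[THEN iffD2, OF that]] obtain z where z: "z \<in> {..<n} - T"
      "\<And>x. x \<in> {..<n} - T \<Longrightarrow> x \<noteq> z \<Longrightarrow>
        (\<forall>u\<in>T. \<not> (z \<rightarrow>\<^bsub>G\<^esub> u \<and> x \<rightarrow>\<^bsub>G\<^esub> u)) \<or> (\<forall>u\<in>T. z \<rightarrow>\<^bsub>G\<^esub> u \<or> x \<rightarrow>\<^bsub>G\<^esub> u)"
      by blast
    have "\<not> conflict z x" if "x < n" for x
    proof
      assume "conflict z x"
      with z(2)[of x] that show False unfolding conflict_def by auto
    qed
    with z(1) show ?thesis unfolding gluing_vertex_def by blast
  qed
  have "matrix_stored (input_state n G)"
    by (rule matrix_stored_input_state) simp
  with triple_decompose_com[OF gv] obtain t s where ts: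
    "exec ((n + 2) ^ 2) decompose_com (input_state n G) t s" "t \<le> bound n decompose_com"
    and s: "regs s 0 = 0 \<and> (\<exists>u<n. \<exists>v<n. violation u v) \<or>
          regs s 0 = 1 \<and> (\<forall>u<n. \<forall>v<n. \<not> violation u v) \<and>
          (\<exists>z<n. gluing_vertex z \<and> (\<forall>x<n. arrs s 1 x = part z x))"
    unfolding triple_def by blast
  from s have "correct_output n G s"
  proof
    assume "regs s 0 = 0 \<and> (\<exists>u<n. \<exists>v<n. violation u v)"
    moreover from this have "\<not> clique_sperner G"
      using labeled_clique_sperner_top_set[OF G(1,2)] L by blast
    ultimately show ?thesis by (simp add: correct_output_def)
  next
    assume "regs s 0 = 1 \<and> (\<forall>u<n. \<forall>v<n. \<not> violation u v) \<and>
          (\<exists>z<n. gluing_vertex z \<and> (\<forall>x<n. arrs s 1 x = part z x))"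
    then show ?thesis
      using correct_output_if_decomposed[OF G refl] L by blast
  qed
  with ts show ?thesis by blast
qed

lemma bound_decompose_com_bigo: "(\<lambda>n. real (bound n decompose_com)) \<in> O(\<lambda>n. real n ^ 3)"
proof (rule bigoI)
  \<comment> \<open>The \<open>8\<close> comes from \<open>n + 1 \<le> 2 * n\<close>, cubed.\<close>
  show "\<forall>\<^sub>F n in sequentially. norm (real (bound n decompose_com))
    \<le> real (weight decompose_com * 8) * norm (real n ^ 3)"
    using eventually_ge_at_top[of 1]
  proof eventually_elim
    case (elim n)
    then have "bound n decompose_com \<le> weight decompose_com * (2 * n) ^ 3"
      unfolding bound_def depth_decompose_com by (intro mult_le_mono2 power_mono) auto
    also have "\<dots> = weight decompose_com * 8 * n ^ 3"
      by (simp add: power_mult_distrib)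
    finally have "real (bound n decompose_com) \<le> real (weight decompose_com * 8 * n ^ 3)"
      by (rule of_nat_mono)
    then show ?case by simp
  qed
qed

theorem theorem5p3:
  shows
    "(\<forall>(G :: ('a, 'b) pre_digraph) K I.
        graph G \<and> card (verts G) \<ge> 2 \<and> H_free G \<and> clique_sperner G \<and>
        labeled_clique_sperner G K I \<longrightarrow>
        (\<exists>z I\<^sub>1 I\<^sub>2 K\<^sub>1 K\<^sub>2. sperner_decomposition G K I z I\<^sub>1 I\<^sub>2 K\<^sub>1 K\<^sub>2)) \<and>
     (\<exists>(prog :: com) (k :: nat) (T :: nat \<Rightarrow> nat).
        (\<lambda>n. real (T n)) \<in> O(\<lambda>n. real n ^ 3) \<and>
        (\<forall>n \<ge> 1. \<forall>G :: (nat, nat \<times> nat) pre_digraph.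
           graph G \<and> verts G = {..<n} \<and> H_free G \<and> split_graph G \<longrightarrow>
           (\<exists>t s. exec ((n + 2) ^ k) prog (input_state n G) t s \<and> t \<le> T n \<and>
                  correct_output n G s)))"
proof (intro conjI allI impI)
  fix G :: "('a, 'b) pre_digraph" and K I
  assume "graph G \<and> card (verts G) \<ge> 2 \<and> H_free G \<and> clique_sperner G \<and> labeled_clique_sperner G K I"
  then show "\<exists>z I\<^sub>1 I\<^sub>2 K\<^sub>1 K\<^sub>2. sperner_decomposition G K I z I\<^sub>1 I\<^sub>2 K\<^sub>1 K\<^sub>2"
    by (metis ex_sperner_decomposition labeled_clique_sperner_indep_nonempty)
next
  show "\<exists>(prog :: com) (k :: nat) (T :: nat \<Rightarrow> nat).
        (\<lambda>n. real (T n)) \<in> O(\<lambda>n. real n ^ 3) \<and>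
        (\<forall>n \<ge> 1. \<forall>G :: (nat, nat \<times> nat) pre_digraph.
           graph G \<and> verts G = {..<n} \<and> H_free G \<and> split_graph G \<longrightarrow>
           (\<exists>t s. exec ((n + 2) ^ k) prog (input_state n G) t s \<and> t \<le> T n \<and>
                  correct_output n G s))"
    by (intro exI[of _ decompose_com] exI[of _ 2] exI[of _ "\<lambda>n. bound n decompose_com"]
        conjI bound_decompose_com_bigo allI impI decompose_com_correct) auto
qed

end
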